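(* Let $\delta>0$ and let $K\ge 1$, $T=KH$. Consider the algorithm UCBVI-CH (UCBVI with the Chernoff–Hoeffding bonus) run for $K$ episodes on any MDP satisfying the standing assumptions. Then, with probability at least $1-\delta$, $$\mathrm{Regret}(K)\;\le\; 20\,H^{3/2}L\sqrt{SAK}+250\,H^2S^2A\,L^2,$$ where $L=\ln(5HSAT/\delta)$.
   Context: Setting: a finite-horizon episodic Markov decision process with finite state set $\mathcal S$ ($|\mathcal S|=S$), finite action set $\mathcal A$ ($|\mathcal A|=A$), unknown transition kernel $P(\cdot\mid x,a)$, known deterministic reward function $R:\mathcal S\times\mathcal A\to[0,1]$, and known horizon $H$. In each episode $k=1,\dots,K$, an initial state $x_{k,1}$ is chosen arbitrarily by the environment (it may change arbitrarily between episodes); then for $h=1,\dots,H$ the agent picks $a_{k,h}\in\mathcal A$ and observes $x_{k,h+1}\sim P(\cdot\mid x_{k,h},a_{k,h})$. A policy is a map $\pi:\mathcal S\times[H]\to\mathcal A$. Its value is $V^\pi_h(x)=\mathbb E\big[\sum_{j=h}^{H}R(x_j,\pi(x_j,j))\mid x_h=x\big]$ (trajectory generated by $P$ and $\pi$), $V^\pi_{H+1}\equiv 0$, and $V^*_h(x)=\sup_\pi V^\pi_h(x)$. If $\pi_k$ is the policy followed in episode $k$, $\mathrm{Regret}(K)=\sum_{k=1}^K\big(V^*_1(x_{k,1})-V^{\pi_k}_1(x_{k,1})\big)$. $T=KH$. Algorithm UCBVI (with a bonus rule $b$): before episode $k$, using all transitions $(x_{i,h},a_{i,h},x_{i,h+1})$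 from episodes $i<k$, let $N_k(x,a,y)$ be the number of such transitions with $(x_{i,h},a_{i,h},x_{i,h+1})=(x,a,y)$, $N_k(x,a)=\sum_y N_k(x,a,y)$, and $\widehat P_k(y\mid x,a)=N_k(x,a,y)/N_k(x,a)$ when $N_k(x,a)>0$. Set $V_{k,H+1}\equiv 0$ and $Q_{0,h}\equiv H$. For $h=H,H-1,\dots,1$ and every $(x,a)$: if $N_k(x,a)>0$, $$Q_{k,h}(x,a)=\min\Big(Q_{k-1,h}(x,a),\,H,\,R(x,a)+\textstyle\sum_y\widehat P_k(y\mid x,a)V_{k,h+1}(y)+b_{k,h}(x,a)\Big),$$ otherwise $Q_{k,h}(x,a)=H$; and $V_{k,h}(x)=\max_a Q_{k,h}(x,a)$. In episode $k$, at step $h$ the agent takes $a_{k,h}\in\arg\max_a Q_{k,h}(x_{k,h},a)$; $\pi_k$ denotes this greedy policy. UCBVI-CH is UCBVI with bonus $b_{k,h}(x,a)=7HL'\sqrt{1/N_k(x,a)}$, where $L'=\ln(5SAT/\delta)$. *)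

theory Defs
  imports "HOL-Probability.Probability"
begin

text \<open>Finite-horizon episodic MDP: states of finite type 's, actions of finite type 'a,
  transition kernel P :: 's => 'a => 's pmf, known reward R :: 's => 'a => real.
  A transition is a triple (x, a, y); an episode is the list of its H transitions;
  a history is the list of completed episodes (episode 1 first).\<close>

type_synonym ('s, 'a) trans = "'s \<times> 'a \<times> 's"
type_synonym ('s, 'a) hist = "('s, 'a) trans list list"

type_synonym ('s, 'a) policy = "'s \<Rightarrow> nat \<Rightarrow> 'a"

fun run_ep :: "('s \<Rightarrow> 'a \<Rightarrow> 's pmf) \<Rightarrow> ('s, 'a) policy \<Rightarrow> 's \<Rightarrow> nat \<Rightarrow> nat
                 \<Rightarrow> ('s, 'a) trans list pmf" where
  "run_ep P \<pi> x h 0 = return_pmf []"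
| "run_ep P \<pi> x h (Suc n) =
     bind_pmf (P x (\<pi> x h))
       (\<lambda>y. map_pmf (\<lambda>tr. (x, \<pi> x h, y) # tr) (run_ep P \<pi> y (Suc h) n))"

definition Vpi1 :: "('s \<Rightarrow> 'a \<Rightarrow> 's pmf) \<Rightarrow> ('s \<Rightarrow> 'a \<Rightarrow> real) \<Rightarrow> nat
                    \<Rightarrow> ('s, 'a) policy \<Rightarrow> 's \<Rightarrow> real" where
  "Vpi1 P R H \<pi> x =
     measure_pmf.expectation (run_ep P \<pi> x 1 H)
       (\<lambda>tr. sum_list (map (\<lambda>(x', a', y'). R x' a') tr))"

definition Vstar1 :: "('s \<Rightarrow> 'a \<Rightarrow> 's pmf) \<Rightarrow> ('s \<Rightarrow> 'a \<Rightarrow> real) \<Rightarrow> nat \<Rightarrow> 's \<Rightarrow> real" where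
  "Vstar1 P R H x = (SUP \<pi>. Vpi1 P R H \<pi> x)"

definition cnt3 :: "('s, 'a) hist \<Rightarrow> 's \<Rightarrow> 'a \<Rightarrow> 's \<Rightarrow> nat" where
  "cnt3 ds x a y = length (filter (\<lambda>t. t = (x, a, y)) (concat ds))"

definition cnt :: "('s::finite, 'a) hist \<Rightarrow> 's \<Rightarrow> 'a \<Rightarrow> nat" where
  "cnt ds x a = (\<Sum>y\<in>UNIV. cnt3 ds x a y)"

definition Phat :: "('s::finite, 'a) hist \<Rightarrow> 's \<Rightarrow> 'a \<Rightarrow> 's \<Rightarrow> real" where
  "Phat ds x a y = real (cnt3 ds x a y) / real (cnt ds x a)"

text \<open>UCBVI with a generic bonus rule b.  For a history ds of the episodes i < k
  (so k = length ds + 1), ucbQ H R b ds h x a is Q_{k,h}(x,a); ucbV is V_{k,h}.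
  The previous iterate Q_{k-1,h} is ucbQ on butlast ds, and Q_{0,h} = H.
  The bonus b ds h x a stands for b_{k,h}(x,a).\<close>
function ucbQ :: "nat \<Rightarrow> ('s::finite \<Rightarrow> 'a::finite \<Rightarrow> real)
                   \<Rightarrow> (('s, 'a) hist \<Rightarrow> nat \<Rightarrow> 's \<Rightarrow> 'a \<Rightarrow> real)
                   \<Rightarrow> ('s, 'a) hist \<Rightarrow> nat \<Rightarrow> 's \<Rightarrow> 'a \<Rightarrow> real" where
  "ucbQ H R b ds h x a =
     (if 0 < cnt ds x a then
        min (min (if ds = [] then real H else ucbQ H R b (butlast ds) h x a) (real H))
            (R x a
             + (\<Sum>y\<in>UNIV. Phat ds x a y *
                   (if H < Suc h then 0 else Max (range (\<lambda>a'. ucbQ H R b ds (Suc h) y a'))))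
             + b ds h x a)
      else real H)"
  by pat_completeness auto
termination
  by (relation "measures [\<lambda>(H, R, b, ds, h, x, a). length ds,
                          \<lambda>(H, R, b, ds, h, x, a). Suc H - h]") auto

definition ucbV :: "nat \<Rightarrow> ('s::finite \<Rightarrow> 'a::finite \<Rightarrow> real)
                   \<Rightarrow> (('s, 'a) hist \<Rightarrow> nat \<Rightarrow> 's \<Rightarrow> 'a \<Rightarrow> real)
                   \<Rightarrow> ('s, 'a) hist \<Rightarrow> nat \<Rightarrow> 's \<Rightarrow> real" where
  "ucbV H R b ds h x = (if H < h then 0 else Max (range (\<lambda>a. ucbQ H R b ds h x a)))"

definition bonus_CH :: "nat \<Rightarrow> nat \<Rightarrow> real \<Rightarrow> ('s::finite, 'a::finite) hist
                        \<Rightarrow> nat \<Rightarrow> 's \<Rightarrow> 'a \<Rightarrow> real" where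
  "bonus_CH H K \<delta> ds h x a =
     7 * real H * ln (5 * real CARD('s) * real CARD('a) * real (K * H) / \<delta>)
       * sqrt (1 / real (cnt ds x a))"

fun hist_pmf :: "('s \<Rightarrow> 'a \<Rightarrow> 's pmf) \<Rightarrow> nat \<Rightarrow> (('s, 'a) hist \<Rightarrow> ('s, 'a) policy)
                  \<Rightarrow> (('s, 'a) hist \<Rightarrow> 's) \<Rightarrow> nat \<Rightarrow> ('s, 'a) hist pmf" where
  "hist_pmf P H pol init 0 = return_pmf []"
| "hist_pmf P H pol init (Suc k) =
     bind_pmf (hist_pmf P H pol init k)
       (\<lambda>ds. map_pmf (\<lambda>ep. ds @ [ep]) (run_ep P (pol ds) (init ds) 1 H))"

text \<open>Regret over K episodes, computed from the full history hs (episode k+1 uses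
  the history prefix take k hs).\<close>
definition regret :: "('s \<Rightarrow> 'a \<Rightarrow> 's pmf) \<Rightarrow> ('s \<Rightarrow> 'a \<Rightarrow> real) \<Rightarrow> nat
                      \<Rightarrow> (('s, 'a) hist \<Rightarrow> ('s, 'a) policy) \<Rightarrow> (('s, 'a) hist \<Rightarrow> 's)
                      \<Rightarrow> nat \<Rightarrow> ('s, 'a) hist \<Rightarrow> real" where
  "regret P R H pol init K hs =
     (\<Sum>k<K. Vstar1 P R H (init (take k hs)) - Vpi1 P R H (pol (take k hs)) (init (take k hs)))"

end

theory Submission
  imports Defs
begin

text \<open>
  Write \<open>N\<close> for a visit count, \<open>L' \<le> L\<close> for the two logarithms and \<open>\<eta> = 1 / (20 H)\<close>.
  Exponential supermartingales along the interaction give three events of total failure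
  probability below \<open>\<delta>\<close>. Hoeffding: the empirical mean of every optimal value function is off by at
  most \<open>H L' / sqrt N\<close>, so the bonus makes all iterates optimistic. Chernoff with the fixed parameter
  \<open>\<eta>\<close>: \<open>Phat \<le> (1 + \<eta>) P + 40 H L / N\<close> pointwise. Azuma: the noise between the expected and the
  realised next gap sums to at most \<open>(4/5) H L sqrt T\<close>.

  On these events the gap \<open>D h = V h - V\<^sup>\<pi> h\<close> of the current policy satisfies
  \<open>D h \<le> 8 H L / sqrt N + 40 S H\<^sup>2 L / N + (1 + \<eta>) P (D (h + 1))\<close>. Since \<open>(1 + \<eta>) ^ H \<le> 1.06\<close>, unrolling
  costs almost nothing. Pairs visited fewer than \<open>10 H\<close> times are charged the trivial bound \<open>H\<close>; for
  the others one episode changes \<open>N\<close> by a factor of at most \<open>11/10\<close>, so that the delayed counts do not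
  spoil the leading constant: \<open>1.06 * 8 * 2.05 + 0.8 < 20\<close>.
\<close>

section \<open>Expectations over finite state spaces\<close>

definition pexp :: "'s::finite pmf \<Rightarrow> ('s \<Rightarrow> real) \<Rightarrow> real" where
  "pexp p f = (\<Sum>y\<in>UNIV. pmf p y * f y)"

lemma expectation_eq_pexp: "measure_pmf.expectation p f = pexp p f"
  unfolding pexp_def
  by (subst integral_measure_pmf_real[where A = UNIV]) (auto simp: mult.commute)

lemma sum_pmf_UNIV: "(\<Sum>y\<in>UNIV. pmf p y) = 1" for p :: "'s::finite pmf"
  by (rule sum_pmf_eq_1) auto

lemma pexp_mono: "(\<And>y. f y \<le> g y) \<Longrightarrow> pexp p f \<le> pexp p g"
  unfolding pexp_def by (intro sum_mono mult_left_mono) auto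

lemma pexp_const: "pexp p (\<lambda>_. c) = c"
  unfolding pexp_def by (simp flip: sum_distrib_right add: sum_pmf_UNIV)

lemma pexp_add: "pexp p (\<lambda>y. f y + g y) = pexp p f + pexp p g"
  unfolding pexp_def by (simp add: sum.distrib algebra_simps)

lemma pexp_diff: "pexp p (\<lambda>y. f y - g y) = pexp p f - pexp p g"
  unfolding pexp_def by (simp add: sum_subtractf algebra_simps)

lemma pexp_cmult: "pexp p (\<lambda>y. c * f y) = c * pexp p f"
  unfolding pexp_def by (simp add: sum_distrib_left algebra_simps)

lemma pexp_minus: "pexp p (\<lambda>y. - f y) = - pexp p f"
  unfolding pexp_def by (simp add: sum_negf)

text \<open>The variance term of Hoeffding's lemma is moved into the exponent, because a bound by 1
  is the one-step condition of the exponential supermartingales below.\<close>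

lemma hoeffding_pmf:
  fixes p :: "'s::finite pmf"
  assumes "\<And>y. a \<le> f y" "\<And>y. f y \<le> b" "l > 0"
  shows "(\<integral>\<^sup>+y. ennreal (exp (l * (f y - pexp p f) - l\<^sup>2 * (b - a)\<^sup>2 / 8)) \<partial>measure_pmf p) \<le> 1"
proof -
  interpret interval_bounded_random_variable "measure_pmf p" f a b
    by unfold_locales (use assms in auto)
  let ?c = "l\<^sup>2 * (b - a)\<^sup>2 / 8"
  have "(\<integral>\<^sup>+y. ennreal (exp (l * (f y - pexp p f) - ?c)) \<partial>measure_pmf p)
      = (\<integral>\<^sup>+y. ennreal (exp (- ?c)) * ennreal (exp (l * (f y - pexp p f))) \<partial>measure_pmf p)"
    by (intro nn_integral_cong) (simp flip: ennreal_mult exp_add)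
  also have "\<dots> = ennreal (exp (- ?c)) * (\<integral>\<^sup>+y. ennreal (exp (l * (f y - pexp p f))) \<partial>measure_pmf p)"
    by (rule nn_integral_cmult) auto
  also have "\<dots> \<le> ennreal (exp (- ?c)) * ennreal (exp ?c)"
    using Hoeffdings_lemma_nn_integral[OF \<open>l > 0\<close>]
    by (intro mult_left_mono) (auto simp: expectation_eq_pexp)
  also have "\<dots> = 1"
    by (simp flip: ennreal_mult exp_add)
  finally show ?thesis .
qed

text \<open>The moment generating function of an indicator is \<open>1 + (exp l - 1) * p\<close>,
  and \<open>exp l - 1 \<le> l * (1 + l)\<close> on [0, 1]. The compensator is proportional to
  \<open>p\<close>, which gives relative instead of additive errors.\<close>

lemma chernoff_pmf:
  fixes p :: "'s::finite pmf"
  assumes "0 \<le> l" "l \<le> 1"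
  shows "(\<integral>\<^sup>+y'. ennreal (exp (l * (of_bool (y' = y) - (1 + l) * pmf p y))) \<partial>measure_pmf p) \<le> 1"
proof -
  let ?p = "pmf p y" and ?c = "l * (1 + l) * pmf p y"
  have "(\<integral>\<^sup>+y'. ennreal (exp (l * (of_bool (y' = y) - (1 + l) * ?p))) \<partial>measure_pmf p)
     = (\<Sum>y'\<in>UNIV. ennreal (exp (l * (of_bool (y' = y) - (1 + l) * ?p))) * ennreal (pmf p y'))"
    by (rule nn_integral_measure_pmf_support) auto
  also have "\<dots> = ennreal (\<Sum>y'\<in>UNIV. exp (l * (of_bool (y' = y) - (1 + l) * ?p)) * pmf p y')"
    by (simp add: sum_ennreal flip: ennreal_mult)
  also have "(\<Sum>y'\<in>UNIV. exp (l * (of_bool (y' = y) - (1 + l) * ?p)) * pmf p y')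
      = (\<Sum>y'\<in>UNIV. exp (- ?c) * (pmf p y' + (if y' = y then (exp l - 1) * ?p else 0)))"
    by (intro sum.cong) (auto simp: algebra_simps exp_diff exp_minus exp_add field_simps)
  also have "\<dots> = exp (- ?c) * (1 + (exp l - 1) * ?p)"
    by (simp add: sum.distrib sum_pmf_UNIV flip: sum_distrib_left)
  also have "\<dots> \<le> exp (- ?c) * exp ?c"
  proof (intro mult_left_mono)
    have "exp l - 1 \<le> l * (1 + l)"
      using exp_bound[OF assms] by (simp add: algebra_simps power2_eq_square)
    hence "1 + (exp l - 1) * ?p \<le> 1 + ?c"
      by (simp add: mult_right_mono)
    also have "\<dots> \<le> exp ?c" by (rule exp_ge_add_one_self)
    finally show "1 + (exp l - 1) * ?p \<le> exp ?c" .
  qed auto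
  also have "\<dots> = 1" by (simp flip: exp_add)
  finally show ?thesis by (simp add: ennreal_leI)
qed

section \<open>Exponential supermartingales along the interaction\<close>

fun ep_sum :: "(nat \<Rightarrow> ('s, 'a) trans \<Rightarrow> real) \<Rightarrow> nat \<Rightarrow> ('s, 'a) trans list \<Rightarrow> real" where
  "ep_sum z h [] = 0"
| "ep_sum z h (t # ts) = z h t + ep_sum z (Suc h) ts"

text \<open>Besides the step and the transition, the increment sees only the episodes completed
  earlier: policy and value estimates of an episode are functions of these.\<close>

definition hist_sum :: "(('s, 'a) hist \<Rightarrow> nat \<Rightarrow> ('s, 'a) trans \<Rightarrow> real) \<Rightarrow> ('s, 'a) hist \<Rightarrow> real" where
  "hist_sum z hs = (\<Sum>i<length hs. ep_sum (z (take i hs)) 1 (hs ! i))"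

lemma hist_sum_Nil [simp]: "hist_sum z [] = 0"
  by (simp add: hist_sum_def)

lemma hist_sum_snoc [simp]: "hist_sum z (hs @ [ep]) = hist_sum z hs + ep_sum (z hs) 1 ep"
  by (simp add: hist_sum_def nth_append)

text \<open>Peeling off the first transition leaves a conditional integral of at most 1. The
  one-step condition ranges over all pairs, so every policy is covered.\<close>

lemma ep_sum_supermartingale:
  fixes z :: "nat \<Rightarrow> ('s, 'a) trans \<Rightarrow> real"
  assumes "\<And>h x a. (\<integral>\<^sup>+y. ennreal (exp (z h (x, a, y))) \<partial>measure_pmf (P x a)) \<le> 1"
  shows "(\<integral>\<^sup>+ts. ennreal (exp (ep_sum z h ts)) \<partial>measure_pmf (run_ep P \<pi> x h n)) \<le> 1"
proof (induction n arbitrary: x h)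
  case (Suc n)
  have "(\<integral>\<^sup>+ts. ennreal (exp (ep_sum z h ts)) \<partial>measure_pmf (run_ep P \<pi> x h (Suc n)))
      = (\<integral>\<^sup>+y. ennreal (exp (z h (x, \<pi> x h, y))) *
          (\<integral>\<^sup>+ts. ennreal (exp (ep_sum z (Suc h) ts)) \<partial>measure_pmf (run_ep P \<pi> y (Suc h) n))
          \<partial>measure_pmf (P x (\<pi> x h)))"
    by (simp add: exp_add ennreal_mult nn_integral_cmult)
  also have "\<dots> \<le> (\<integral>\<^sup>+y. ennreal (exp (z h (x, \<pi> x h, y))) * 1 \<partial>measure_pmf (P x (\<pi> x h)))"
    by (intro nn_integral_mono mult_left_mono Suc.IH) auto
  also have "\<dots> \<le> 1" using assms by simp
  finally show ?case .
qed simp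

lemma hist_sum_supermartingale:
  fixes z :: "('s, 'a) hist \<Rightarrow> nat \<Rightarrow> ('s, 'a) trans \<Rightarrow> real"
  assumes "\<And>ds h x a. (\<integral>\<^sup>+y. ennreal (exp (z ds h (x, a, y))) \<partial>measure_pmf (P x a)) \<le> 1"
  shows "(\<integral>\<^sup>+hs. ennreal (exp (hist_sum z hs)) \<partial>measure_pmf (hist_pmf P H pol init k)) \<le> 1"
proof (induction k)
  case (Suc k)
  have "(\<integral>\<^sup>+hs. ennreal (exp (hist_sum z hs)) \<partial>measure_pmf (hist_pmf P H pol init (Suc k)))
      = (\<integral>\<^sup>+ds. ennreal (exp (hist_sum z ds)) *
          (\<integral>\<^sup>+ep. ennreal (exp (ep_sum (z ds) 1 ep)) \<partial>measure_pmf (run_ep P (pol ds) (init ds) 1 H))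
          \<partial>measure_pmf (hist_pmf P H pol init k))"
    by (simp add: exp_add ennreal_mult nn_integral_cmult)
  also have "\<dots> \<le> (\<integral>\<^sup>+ds. ennreal (exp (hist_sum z ds)) * 1 \<partial>measure_pmf (hist_pmf P H pol init k))"
    by (intro nn_integral_mono mult_left_mono ep_sum_supermartingale assms) auto
  also have "\<dots> \<le> 1" using Suc by simp
  finally show ?case .
qed simp

lemma prob_hist_sum_ge:
  fixes z :: "('s, 'a) hist \<Rightarrow> nat \<Rightarrow> ('s, 'a) trans \<Rightarrow> real"
  assumes "\<And>ds h x a. (\<integral>\<^sup>+y. ennreal (exp (z ds h (x, a, y))) \<partial>measure_pmf (P x a)) \<le> 1"
  shows "measure_pmf.prob (hist_pmf P H pol init k) {hs. c \<le> hist_sum z hs} \<le> exp (- c)"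
proof -
  let ?M = "measure_pmf (hist_pmf P H pol init k)"
  have "emeasure ?M {hs \<in> UNIV. 1 \<le> ennreal (exp (- c)) * ennreal (exp (hist_sum z hs))}
      \<le> ennreal (exp (- c)) * (\<integral>\<^sup>+hs. ennreal (exp (hist_sum z hs)) * indicator UNIV hs \<partial>?M)"
    by (rule nn_integral_Markov_inequality) auto
  also have "\<dots> \<le> ennreal (exp (- c)) * 1"
    using hist_sum_supermartingale[OF assms] by (intro mult_left_mono) auto
  also have "{hs \<in> UNIV. 1 \<le> ennreal (exp (- c)) * ennreal (exp (hist_sum z hs))}
      = {hs. c \<le> hist_sum z hs}"
    by (auto simp flip: ennreal_mult exp_add)
  finally show ?thesis
    by (simp add: measure_pmf.emeasure_eq_measure)
qed

text \<open>Stopping after \<open>k\<close> episodes turns tail bounds for the full history into tail bounds for its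
  prefixes.\<close>

definition frozen :: "nat \<Rightarrow> (('s, 'a) trans \<Rightarrow> real) \<Rightarrow> ('s, 'a) hist \<Rightarrow> nat \<Rightarrow> ('s, 'a) trans \<Rightarrow> real" where
  "frozen k z ds h t = (if length ds < k then z t else 0)"

lemma ep_sum_const: "ep_sum (\<lambda>_. z) h ts = sum_list (map z ts)"
  by (induction ts arbitrary: h) auto

lemma hist_sum_frozen: "hist_sum (frozen k z) hs = sum_list (map z (concat (take k hs)))"
proof (induction hs rule: rev_induct)
  case (snoc ep hs)
  have "ep_sum (frozen k z hs) 1 ep = (if length hs < k then sum_list (map z ep) else 0)"
    using ep_sum_const[of z 1 ep] ep_sum_const[of "\<lambda>_. 0" 1 ep] by (auto simp: frozen_def[abs_def])
  thus ?case using snoc by (cases "k \<le> length hs") auto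
qed simp

lemma prob_frozen_ge:
  fixes z :: "('s, 'a) trans \<Rightarrow> real"
  assumes "\<And>x a. (\<integral>\<^sup>+y. ennreal (exp (z (x, a, y))) \<partial>measure_pmf (P x a)) \<le> 1"
  shows "measure_pmf.prob (hist_pmf P H pol init K)
    {hs. c \<le> sum_list (map z (concat (take k hs)))} \<le> exp (- c)"
  unfolding hist_sum_frozen[symmetric]
proof (rule prob_hist_sum_ge)
  show "(\<integral>\<^sup>+y. ennreal (exp (frozen k z ds h (x, a, y))) \<partial>measure_pmf (P x a)) \<le> 1" for ds h x a
    using assms by (cases "length ds < k") (auto simp: frozen_def)
qed

section \<open>Visit counts\<close>

lemma sum_list_cnt3:
  fixes ds :: "('s::finite, 'a) hist"
  shows "sum_list (map (\<lambda>(x', a', y). if x' = x \<and> a' = a then g y else 0) (concat ds))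
     = (\<Sum>y\<in>UNIV. real (cnt3 ds x a y) * g y)"
proof -
  have "sum_list (map (\<lambda>(x', a', y). if x' = x \<and> a' = a then g y else 0) ts)
     = (\<Sum>y\<in>UNIV. real (length (filter (\<lambda>t. t = (x, a, y)) ts)) * g y)" for ts :: "('s, 'a) trans list"
  proof (induction ts)
    case (Cons t ts)
    obtain x' a' y' where t: "t = (x', a', y')" by (cases t)
    have "(\<Sum>y\<in>UNIV. real (length (filter (\<lambda>t. t = (x, a, y)) (t # ts))) * g y)
       = (\<Sum>y\<in>UNIV. real (length (filter (\<lambda>t. t = (x, a, y)) ts)) * g y
            + (if y = y' then (if x' = x \<and> a' = a then g y else 0) else 0))"
      by (intro sum.cong) (auto simp: t algebra_simps)
    also have "\<dots> = (\<Sum>y\<in>UNIV. real (length (filter (\<lambda>t. t = (x, a, y)) ts)) * g y)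
            + (if x' = x \<and> a' = a then g y' else 0)"
      by (simp add: sum.distrib)
    finally show ?case using Cons by (simp add: t)
  qed simp
  thus ?thesis by (simp add: cnt3_def)
qed

lemma cnt_sum_Phat: "real (cnt ds x a) * (\<Sum>y\<in>UNIV. Phat ds x a y * f y)
   = (\<Sum>y\<in>UNIV. real (cnt3 ds x a y) * f y)" for f :: "'s::finite \<Rightarrow> real"
proof (cases "cnt ds x a = 0")
  case True
  hence "\<And>y. cnt3 ds x a y = 0" by (simp add: cnt_def)
  thus ?thesis using True by simp
next
  case False
  thus ?thesis by (simp add: Phat_def sum_distrib_left)
qed

text \<open>An increment supported on one pair sums to the count times a centred empirical mean;
  this is how tail bounds for sums along the history become tail bounds for \<open>Phat\<close>.
  With no visits both sides vanish.\<close>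

lemma sum_list_visits:
  fixes ds :: "('s::finite, 'a) hist"
  shows "sum_list (map (\<lambda>(x', a', y). if x' = x \<and> a' = a then l * f y - c else 0) (concat ds))
     = real (cnt ds x a) * (l * (\<Sum>y\<in>UNIV. Phat ds x a y * f y) - c)"
proof -
  have "(\<Sum>y\<in>UNIV. real (cnt3 ds x a y) * (l * f y - c))
      = l * (\<Sum>y\<in>UNIV. real (cnt3 ds x a y) * f y) - c * real (cnt ds x a)"
    by (simp add: cnt_def sum_subtractf sum_distrib_left algebra_simps)
  also have "\<dots> = real (cnt ds x a) * (l * (\<Sum>y\<in>UNIV. Phat ds x a y * f y) - c)"
    unfolding cnt_sum_Phat[symmetric] by (simp add: right_diff_distrib)
  finally show ?thesis by (simp add: sum_list_cnt3)
qed

lemma cnt_Nil [simp]: "cnt [] x a = 0"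
  by (simp add: cnt_def cnt3_def)

lemma cnt_append: "cnt (ds @ es) x a = cnt ds x a + cnt es x a"
  by (simp add: cnt_def cnt3_def sum.distrib)

lemma cnt_eq_length_filter:
  "cnt ds x a = length (filter (\<lambda>(x', a', y). x' = x \<and> a' = a) (concat ds))"
proof -
  have *: "sum_list (map (\<lambda>(x', a', y). if x' = x \<and> a' = a then 1 else 0) ts)
     = real (length (filter (\<lambda>(x', a', y). x' = x \<and> a' = a) ts))" for ts :: "('a, 'b) trans list"
    by (induction ts) (auto split: if_splits)
  have "real (cnt ds x a) = real (length (filter (\<lambda>(x', a', y). x' = x \<and> a' = a) (concat ds)))"
    using sum_list_cnt3[of x a "\<lambda>_. 1" ds] by (simp add: * cnt_def)
  thus ?thesis by (simp only: of_nat_eq_iff)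
qed

text \<open>An episode is read as the one-element history \<open>[ep]\<close>, so that
  \<open>cnt_append\<close> describes how it changes the counts.\<close>

lemma sum_list_by_visits:
  fixes g :: "'s::finite \<Rightarrow> 'a::finite \<Rightarrow> real"
  shows "sum_list (map (\<lambda>(x, a, y). g x a) ep) = (\<Sum>(x, a)\<in>UNIV. real (cnt [ep] x a) * g x a)"
proof (induction ep)
  case (Cons t ep)
  obtain x' a' y' where t: "t = (x', a', y')" by (cases t)
  have "(\<Sum>(x, a)\<in>UNIV. real (cnt [t # ep] x a) * g x a)
     = (\<Sum>p\<in>UNIV. (case p of (x, a) \<Rightarrow> real (cnt [ep] x a) * g x a)
          + (if p = (x', a') then g x' a' else 0))"
    by (intro sum.cong) (auto simp: cnt_eq_length_filter t distrib_right split: if_splits)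
  also have "\<dots> = (\<Sum>(x, a)\<in>UNIV. real (cnt [ep] x a) * g x a) + g x' a'"
    by (simp add: sum.distrib)
  finally show ?case using Cons by (simp add: t)
qed (simp add: cnt_eq_length_filter)

lemma sum_cnt: "(\<Sum>(x, a)\<in>UNIV. cnt ds x a) = length (concat ds)"
  for ds :: "('s::finite, 'a::finite) hist"
proof -
  have "cnt [concat ds] x a = cnt ds x a" for x a
    by (simp add: cnt_eq_length_filter)
  moreover have "sum_list (map (\<lambda>(x, a, y). 1::real) (ts :: ('s, 'a) trans list)) = real (length ts)" for ts
    by (induction ts) auto
  ultimately have "real (\<Sum>(x, a)\<in>UNIV. cnt ds x a) = real (length (concat ds))"
    using sum_list_by_visits[of "\<lambda>_ _. 1" "concat ds"] by (simp add: case_prod_unfold)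
  thus ?thesis by (simp only: of_nat_eq_iff)
qed

section \<open>Shape of the sampled histories\<close>

fun follows :: "('s, 'a) policy \<Rightarrow> 's \<Rightarrow> nat \<Rightarrow> ('s, 'a) trans list \<Rightarrow> bool" where
  "follows \<pi> x h [] = True"
| "follows \<pi> x h ((x', a, y) # ts) = (x' = x \<and> a = \<pi> x h \<and> follows \<pi> y (Suc h) ts)"

lemma set_run_ep:
  "ts \<in> set_pmf (run_ep P \<pi> x h n) \<Longrightarrow> length ts = n \<and> follows \<pi> x h ts"
proof (induction n arbitrary: x h ts)
  case (Suc n)
  then obtain y ts' where "ts = (x, \<pi> x h, y) # ts'" "ts' \<in> set_pmf (run_ep P \<pi> y (Suc h) n)"
    by auto
  thus ?case using Suc.IH by auto
qed simp

text \<open>Collects what holds almost surely for a sampled history, so that the regret bound on the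
  good event can be argued path by path.\<close>

definition valid_hist :: "nat \<Rightarrow> (('s, 'a) hist \<Rightarrow> ('s, 'a) policy) \<Rightarrow> (('s, 'a) hist \<Rightarrow> 's)
    \<Rightarrow> ('s, 'a) hist \<Rightarrow> bool" where
  "valid_hist H pol init hs = (\<forall>i<length hs. length (hs ! i) = H \<and>
     follows (pol (take i hs)) (init (take i hs)) 1 (hs ! i))"

lemma set_hist_pmf:
  "hs \<in> set_pmf (hist_pmf P H pol init k) \<Longrightarrow> length hs = k \<and> valid_hist H pol init hs"
proof (induction k arbitrary: hs)
  case (Suc k)
  then obtain ds ep where ds: "ds \<in> set_pmf (hist_pmf P H pol init k)" "hs = ds @ [ep]"
    "ep \<in> set_pmf (run_ep P (pol ds) (init ds) 1 H)"
    by auto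
  thus ?case
    using Suc.IH[OF ds(1)] set_run_ep[OF ds(3)]
    by (auto simp: valid_hist_def nth_append less_Suc_eq)
qed (simp add: valid_hist_def)

lemma length_concat_valid:
  "valid_hist H pol init hs \<Longrightarrow> length (concat hs) = length hs * H"
proof -
  assume "valid_hist H pol init hs"
  hence "\<forall>ep\<in>set hs. length ep = H"
    by (auto simp: valid_hist_def in_set_conv_nth)
  thus ?thesis by (induction hs) auto
qed

section \<open>Value functions\<close>

text \<open>The argument \<open>n\<close> of both value functions is the number of remaining steps; \<open>h\<close> is the current
  step, on which only the policy depends.\<close>

fun Vopt :: "('s::finite \<Rightarrow> 'a::finite \<Rightarrow> 's pmf) \<Rightarrow> ('s \<Rightarrow> 'a \<Rightarrow> real) \<Rightarrow> nat \<Rightarrow> 's \<Rightarrow> real" where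
  "Vopt P R 0 x = 0"
| "Vopt P R (Suc n) x = Max (range (\<lambda>a. R x a + pexp (P x a) (Vopt P R n)))"

fun Vpol :: "('s::finite \<Rightarrow> 'a \<Rightarrow> 's pmf) \<Rightarrow> ('s \<Rightarrow> 'a \<Rightarrow> real) \<Rightarrow> ('s, 'a) policy \<Rightarrow> nat
    \<Rightarrow> nat \<Rightarrow> 's \<Rightarrow> real" where
  "Vpol P R \<pi> h 0 x = 0"
| "Vpol P R \<pi> h (Suc n) x = R x (\<pi> x h) + pexp (P x (\<pi> x h)) (Vpol P R \<pi> (Suc h) n)"

lemma finite_set_run_ep: "finite (set_pmf (run_ep P \<pi> x h n))"
  for P :: "'s::finite \<Rightarrow> 'a \<Rightarrow> 's pmf"
  by (induction n arbitrary: x h) auto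

lemma expectation_run_ep:
  fixes P :: "'s::finite \<Rightarrow> 'a \<Rightarrow> 's pmf"
  shows "measure_pmf.expectation (run_ep P \<pi> x h n)
     (\<lambda>tr. sum_list (map (\<lambda>(x', a', y'). R x' a') tr)) = Vpol P R \<pi> h n x"
proof (induction n arbitrary: x h)
  case (Suc n)
  let ?r = "\<lambda>tr. sum_list (map (\<lambda>(x', a', y'). R x' a') tr)"
  have "measure_pmf.expectation (run_ep P \<pi> x h (Suc n)) ?r
     = (\<Sum>y\<in>UNIV. pmf (P x (\<pi> x h)) y *
         measure_pmf.expectation (run_ep P \<pi> y (Suc h) n) (\<lambda>tr. R x (\<pi> x h) + ?r tr))"
    unfolding run_ep.simps
    by (subst pmf_expectation_bind[where A = UNIV]) (auto simp: finite_set_run_ep)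
  also have "\<dots> = pexp (P x (\<pi> x h)) (\<lambda>y. R x (\<pi> x h) + Vpol P R \<pi> (Suc h) n y)"
    unfolding pexp_def
    by (intro sum.cong refl arg_cong2[where f = "(*)"], subst Bochner_Integration.integral_add)
       (auto simp: Suc integrable_measure_pmf_finite finite_set_run_ep)
  also have "\<dots> = Vpol P R \<pi> h (Suc n) x"
    by (simp add: pexp_add pexp_const)
  finally show ?case .
qed simp

lemma Vpi1_eq_Vpol: "Vpi1 P R H \<pi> x = Vpol P R \<pi> 1 H x"
  unfolding Vpi1_def by (rule expectation_run_ep)

lemma Vopt_ge: "R x a + pexp (P x a) (Vopt P R n) \<le> Vopt P R (Suc n) x"
  by (auto intro!: Max_ge)

lemma Vpol_le_Vopt: "Vpol P R \<pi> h n x \<le> Vopt P R n x"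
proof (induction n arbitrary: h x)
  case (Suc n)
  have "Vpol P R \<pi> h (Suc n) x \<le> R x (\<pi> x h) + pexp (P x (\<pi> x h)) (Vopt P R n)"
    using Suc by (auto intro!: pexp_mono)
  also have "\<dots> \<le> Vopt P R (Suc n) x" by (rule Vopt_ge)
  finally show ?case .
qed simp

lemma Vpol_nonneg:
  assumes "\<And>x a. 0 \<le> R x a"
  shows "0 \<le> Vpol P R \<pi> h n x"
proof (induction n arbitrary: h x)
  case (Suc n)
  have "pexp (P x (\<pi> x h)) (\<lambda>_. 0) \<le> pexp (P x (\<pi> x h)) (Vpol P R \<pi> (Suc h) n)"
    by (intro pexp_mono Suc)
  thus ?case using assms[of x "\<pi> x h"] by (simp add: pexp_const)
qed simp

lemma Vopt_nonneg:
  assumes "\<And>x a. 0 \<le> R x a"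
  shows "0 \<le> Vopt P R n x"
  by (rule order_trans[OF Vpol_nonneg[OF assms] Vpol_le_Vopt])

lemma Vopt_le:
  assumes "\<And>x a. R x a \<le> 1"
  shows "Vopt P R n x \<le> real n"
proof (induction n arbitrary: x)
  case (Suc n)
  have "R x a + pexp (P x a) (Vopt P R n) \<le> 1 + real n" for a
    using pexp_mono[of "Vopt P R n" "\<lambda>_. real n" "P x a", OF Suc] assms[of x a]
    by (simp add: pexp_const)
  thus ?case by simp
qed simp

text \<open>Since the iterates dominate \<open>Vopt\<close> on the good event, this direction bounds
  the regret by the gap of the iterates.\<close>

lemma Vstar1_le_Vopt: "Vstar1 P R H x \<le> Vopt P R H x"
  unfolding Vstar1_def by (intro cSUP_least) (auto simp: Vpi1_eq_Vpol Vpol_le_Vopt)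

section \<open>A potential for the visit costs\<close>

definition visit_cost :: "nat \<Rightarrow> real \<Rightarrow> real \<Rightarrow> nat \<Rightarrow> real" where
  "visit_cost H b c N = (if N < 10 * H then real H else b / sqrt (real N) + c / real N)"

text \<open>A discrete antiderivative of \<open>visit_cost\<close>. The cap \<open>11 * H\<close> is
  out of reach for an episode that starts below \<open>10 * H\<close>; the factors 41/20 and 11/10,
  instead of 2 and 1, pay for counts being updated only between episodes.\<close>

definition visit_pot :: "nat \<Rightarrow> real \<Rightarrow> real \<Rightarrow> nat \<Rightarrow> real" where
  "visit_pot H b c N = real H * real (min N (11 * H)) + b * (41 / 20) * sqrt (real N)
     + c * (11 / 10) * ln (real (max 1 N))"

text \<open>All \<open>n\<close> visits of an episode are charged at the count \<open>N\<close> from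
  before it. Below \<open>10 * H\<close> the linear term pays for them, above it the square root and
  the logarithm do.\<close>

lemma visit_cost_le_pot_diff:
  assumes "n \<le> H" "1 \<le> H" "0 \<le> b" "0 \<le> c"
  shows "real n * visit_cost H b c N \<le> visit_pot H b c (N + n) - visit_pot H b c N"
proof (cases "N < 10 * H")
  case True
  have "min (N + n) (11 * H) = N + n" "min N (11 * H) = N"
    using True assms by auto
  moreover have "b * (41 / 20) * sqrt (real N) \<le> b * (41 / 20) * sqrt (real (N + n))"
    using assms by (intro mult_left_mono) auto
  moreover have "c * (11 / 10) * ln (real (max 1 N)) \<le> c * (11 / 10) * ln (real (max 1 (N + n)))"
    using assms by (intro mult_left_mono) auto
  ultimately show ?thesis
    using True by (simp add: visit_cost_def visit_pot_def distrib_left)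
next
  case False
  define M where "M = N + n"
  have N: "N \<ge> 10 * H" "N \<ge> 1" "N > 0" using False assms by auto
  \<comment> \<open>Here \<open>n \<le> H \<le> N / 10\<close>.\<close>
  have M: "M \<ge> N" "10 * real M \<le> 11 * real N"
    using N assms by (auto simp: M_def)
  define s t where "s = sqrt (real N)" and "t = sqrt (real M)"
  have s: "s > 0" "s \<le> t" "s\<^sup>2 = real N" "t\<^sup>2 = real M"
    using N M by (auto simp: s_def t_def)
  have "(21 / 20 * s)\<^sup>2 = 441 / 400 * real N"
    unfolding power_mult_distrib s(3) by (simp add: power2_eq_square)
  moreover have "0 \<le> real N" by simp
  ultimately have "t\<^sup>2 \<le> (21 / 20 * s)\<^sup>2"
    using M(2) s(4) by linarith
  \<comment> \<open>The square of 21/20 is 1.1025, just above 11/10; it makes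
    \<open>t + s \<le> 41 / 20 * s\<close> below.\<close>
  hence t: "t \<le> 21 / 20 * s"
    by (rule power2_le_imp_le) (use s(1) in simp)
  have n: "real n = t\<^sup>2 - s\<^sup>2" unfolding s(3,4) by (simp add: M_def)
  have "real n / s = (t - s) * (t + s) / s"
    by (simp add: n power2_eq_square algebra_simps)
  also have "\<dots> \<le> (t - s) * (41 / 20 * s) / s"
    using s(1,2) t by (intro divide_right_mono mult_left_mono) auto
  finally have 1: "real n / s \<le> 41 / 20 * (t - s)"
    using s(1) by (simp add: mult.commute)
  \<comment> \<open>The logarithm controls \<open>n / M\<close> with the new count; returning to the
    old count \<open>N\<close> costs the factor 11/10.\<close>
  have "ln (real N / real M) \<le> real N / real M - 1"
    using N M by (intro ln_le_minus_one) auto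
  also have "real N / real M - 1 = - (real n / real M)"
    using N M by (simp add: field_simps M_def)
  finally have "real n / real M \<le> ln (real M) - ln (real N)"
    using N M by (simp add: ln_div)
  hence "11 / 10 * (real n / real M) \<le> 11 / 10 * (ln (real M) - ln (real N))"
    by (intro mult_left_mono) auto
  moreover have "real n / real N \<le> 11 / 10 * (real n / real M)"
  proof -
    have "real n * (10 * real M) \<le> real n * (11 * real N)"
      using M by (intro mult_left_mono) auto
    thus ?thesis using N M by (simp add: field_simps)
  qed
  ultimately have 2: "real n / real N \<le> 11 / 10 * (ln (real M) - ln (real N))"
    by (rule order_trans[rotated])
  have "real n * visit_cost H b c N = b * (real n / s) + c * (real n / real N)"
    using False by (simp add: visit_cost_def s_def algebra_simps)
  also have "\<dots> \<le> b * (41 / 20 * (t - s)) + c * (11 / 10 * (ln (real M) - ln (real N)))"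
    using 1 2 assms by (intro add_mono mult_left_mono)
  also have "\<dots> \<le> visit_pot H b c M - visit_pot H b c N"
  proof -
    have "real H * real (min N (11 * H)) \<le> real H * real (min M (11 * H))"
      using M by (intro mult_left_mono) auto
    moreover have "max 1 N = N" "max 1 M = M" using N M by auto
    ultimately show ?thesis
      unfolding visit_pot_def s_def[symmetric] t_def[symmetric] by (simp add: right_diff_distrib)
  qed
  finally show ?thesis by (simp add: M_def)
qed

lemma cnt_single_le_length: "cnt [ep] x a \<le> length ep"
  by (simp add: cnt_eq_length_filter)

text \<open>Telescoping over the episodes, pair by pair; the potential vanishes at count 0.\<close>

lemma visit_costs_le_pot:
  fixes hs :: "('s::finite, 'a::finite) hist"
  assumes "\<And>i. i < length hs \<Longrightarrow> length (hs ! i) = H" "1 \<le> H" "0 \<le> b" "0 \<le> c"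
  shows "(\<Sum>i<length hs. sum_list (map (\<lambda>(x, a, y). visit_cost H b c (cnt (take i hs) x a)) (hs ! i)))
     \<le> (\<Sum>(x, a)\<in>UNIV. visit_pot H b c (cnt hs x a))"
  using assms(1)
proof (induction hs rule: rev_induct)
  case Nil
  thus ?case by (simp add: visit_pot_def)
next
  case (snoc ep hs)
  have "length (hs ! i) = H" if "i < length hs" for i
    using snoc.prems[of i] that by (simp add: nth_append)
  note IH = snoc.IH[OF this]
  have ep: "length ep = H"
    using snoc.prems[of "length hs"] by simp
  have "sum_list (map (\<lambda>(x, a, y). visit_cost H b c (cnt hs x a)) ep)
     = (\<Sum>(x, a)\<in>UNIV. real (cnt [ep] x a) * visit_cost H b c (cnt hs x a))"
    by (rule sum_list_by_visits)
  also have "\<dots> \<le> (\<Sum>(x, a)\<in>UNIV. visit_pot H b c (cnt (hs @ [ep]) x a) - visit_pot H b c (cnt hs x a))"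
    using assms(2-) cnt_single_le_length[of ep] unfolding ep
    by (intro sum_mono) (simp add: case_prod_unfold cnt_append visit_cost_le_pot_diff)
  finally show ?case using IH
    by (simp add: nth_append case_prod_unfold sum_subtractf)
qed

text \<open>Cauchy-Schwarz over all pairs handles the square roots, whose arguments sum to
  \<open>T\<close>; the other two terms are bounded for each pair separately.\<close>

lemma sum_visit_pot_le:
  fixes hs :: "('s::finite, 'a::finite) hist"
  assumes "0 \<le> b" "0 \<le> c" "length (concat hs) = T" "1 \<le> T" "ln (real T) \<le> L"
  shows "(\<Sum>(x, a)\<in>UNIV. visit_pot H b c (cnt hs x a))
    \<le> 11 * (real H)\<^sup>2 * (real CARD('s) * real CARD('a))
       + b * (41 / 20) * sqrt (real CARD('s) * real CARD('a) * real T)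
       + c * (11 / 10) * L * (real CARD('s) * real CARD('a))"
proof -
  let ?SA = "real CARD('s) * real CARD('a)"
  let ?N = "\<lambda>p. cnt hs (fst p) (snd p)"
  have N: "(\<Sum>p\<in>UNIV. ?N p) = T"
    using sum_cnt[of hs] assms by (simp add: case_prod_unfold)
  have N': "?N p \<le> T" for p
    unfolding N[symmetric] by (rule member_le_sum) auto
  have card: "real CARD('s \<times> 'a) = ?SA" by simp
  have "(\<Sum>p\<in>UNIV. sqrt (real (?N p)))\<^sup>2
      \<le> (\<Sum>p\<in>UNIV. (sqrt (real (?N p)))\<^sup>2) * real CARD('s \<times> 'a)"
    by (rule sum_squared_le_sum_of_squares)
  also have "\<dots> = real T * ?SA"
    unfolding card N[symmetric] by simp
  finally have sq: "(\<Sum>p\<in>UNIV. sqrt (real (?N p))) \<le> sqrt (?SA * real T)"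
    by (intro real_le_rsqrt) (simp add: mult.commute)
  have l: "ln (real (max 1 (?N p))) \<le> L" for p
  proof -
    have "ln (real (max 1 (?N p))) \<le> ln (real T)"
      using N'[of p] assms(4) by (subst ln_le_cancel_iff) auto
    thus ?thesis using assms(5) by linarith
  qed
  have "(\<Sum>(x, a)\<in>UNIV. visit_pot H b c (cnt hs x a)) = (\<Sum>p\<in>UNIV. visit_pot H b c (?N p))"
    by (simp add: case_prod_unfold)
  also have "\<dots> \<le> (\<Sum>p\<in>UNIV. 11 * (real H)\<^sup>2 + b * (41 / 20) * sqrt (real (?N p)) + c * (11 / 10) * L)"
  proof (intro sum_mono)
    fix p :: "'s \<times> 'a"
    have "real H * real (min (?N p) (11 * H)) \<le> real H * real (11 * H)"
      by (intro mult_left_mono) auto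
    moreover have "c * (11 / 10) * ln (real (max 1 (?N p))) \<le> c * (11 / 10) * L"
      using assms(2) l by (intro mult_left_mono) auto
    ultimately show "visit_pot H b c (?N p)
        \<le> 11 * (real H)\<^sup>2 + b * (41 / 20) * sqrt (real (?N p)) + c * (11 / 10) * L"
      by (simp add: visit_pot_def power2_eq_square)
  qed
  also have "\<dots> = 11 * (real H)\<^sup>2 * ?SA + b * (41 / 20) * (\<Sum>p\<in>UNIV. sqrt (real (?N p)))
       + c * (11 / 10) * L * ?SA"
    by (simp add: sum.distrib sum_distrib_left)
  also have "\<dots> \<le> 11 * (real H)\<^sup>2 * ?SA + b * (41 / 20) * sqrt (?SA * real T) + c * (11 / 10) * L * ?SA"
    using sq assms(1) by (intro add_mono mult_left_mono order_refl) auto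
  finally show ?thesis .
qed

section \<open>Regret on the good event\<close>

declare ucbQ.simps [simp del]

text \<open>Naming the cardinalities and logarithms by equations keeps them opaque in the
  arithmetic. The restriction \<open>\<delta> < 1\<close> makes the arguments of the logarithms at
  least 5.\<close>

locale ucbvi =
  fixes P :: "'s::finite \<Rightarrow> 'a::finite \<Rightarrow> 's pmf"
    and R :: "'s \<Rightarrow> 'a \<Rightarrow> real"
    and H K :: nat
    and \<delta> :: real
    and init :: "('s, 'a) hist \<Rightarrow> 's"
    and sel :: "('s, 'a) hist \<Rightarrow> 's \<Rightarrow> nat \<Rightarrow> 'a"
    and S A L L' :: real
  assumes R_nonneg: "0 \<le> R x a" and R_le_1: "R x a \<le> 1"
    and H_pos: "1 \<le> H"
    and K_pos: "1 \<le> K"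
    and delta: "0 < \<delta>" "\<delta> < 1"
    and greedy: "ucbQ H R (bonus_CH H K \<delta>) ds h x a \<le> ucbQ H R (bonus_CH H K \<delta>) ds h x (sel ds x h)"
    and S_eq: "S = real CARD('s)"
    and A_eq: "A = real CARD('a)"
    and L_eq: "L = ln (5 * real H * S * A * real (K * H) / \<delta>)"
    and L'_eq: "L' = ln (5 * S * A * real (K * H) / \<delta>)"
begin

abbreviation "Q \<equiv> ucbQ H R (bonus_CH H K \<delta>)"
abbreviation "V \<equiv> ucbV H R (bonus_CH H K \<delta>)"
abbreviation "W \<equiv> Vopt P R"
abbreviation "phat ds x a f \<equiv> \<Sum>y\<in>UNIV. Phat ds x a y * f y"

definition eta :: real where "eta = 1 / (20 * real H)"

text \<open>The truncation at 0 keeps the gap in \<open>[0, H]\<close> for every history, as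
  Hoeffding's lemma demands even where optimism fails. \<open>Suc H - h\<close> counts the remaining
  steps, step \<open>h\<close> included.\<close>

definition gap :: "('s, 'a) hist \<Rightarrow> nat \<Rightarrow> 's \<Rightarrow> real" where
  "gap ds h x = max 0 (V ds h x - Vpol P R (sel ds) h (Suc H - h) x)"

text \<open>The weight absorbs the factor \<open>1 + eta\<close> of the gap recursion, which thereby becomes additive.\<close>

definition wgap :: "('s, 'a) hist \<Rightarrow> nat \<Rightarrow> 's \<Rightarrow> real" where
  "wgap ds h x = (1 + eta) ^ h * gap ds h x"

definition xi :: "('s, 'a) hist \<Rightarrow> nat \<Rightarrow> ('s, 'a) trans \<Rightarrow> real" where
  "xi ds h = (\<lambda>(x, a, y). pexp (P x a) (wgap ds (Suc h)) - wgap ds (Suc h) y)"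

text \<open>Two-sided, but only for the fixed functions \<open>W n\<close>. The data-dependent
  remainder \<open>V - W\<close> is left to \<open>conc_up\<close>, which holds state by state and
  hence for any nonnegative function.\<close>

definition conc_opt :: "('s, 'a) hist \<Rightarrow> bool" where
  "conc_opt hs \<longleftrightarrow> (\<forall>k<K. \<forall>n<H. \<forall>x a. 0 < cnt (take k hs) x a \<longrightarrow>
     \<bar>phat (take k hs) x a (W n) - pexp (P x a) (W n)\<bar> \<le> real H * L' / sqrt (real (cnt (take k hs) x a)))"

definition conc_up :: "('s, 'a) hist \<Rightarrow> bool" where
  "conc_up hs \<longleftrightarrow> (\<forall>k<K. \<forall>x a y. 0 < cnt (take k hs) x a \<longrightarrow>
     Phat (take k hs) x a y \<le> (1 + eta) * pmf (P x a) y + 40 * real H * L / real (cnt (take k hs) x a))"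

definition conc_mart :: "('s, 'a) hist \<Rightarrow> bool" where
  "conc_mart hs \<longleftrightarrow> hist_sum xi hs \<le> 4 / 5 * real H * L * sqrt (real (K * H))"

lemma conc_optD:
  "conc_opt hs \<Longrightarrow> k < K \<Longrightarrow> n < H \<Longrightarrow> 0 < cnt (take k hs) x a \<Longrightarrow>
   \<bar>phat (take k hs) x a (W n) - pexp (P x a) (W n)\<bar> \<le> real H * L' / sqrt (real (cnt (take k hs) x a))"
  unfolding conc_opt_def by blast

lemma conc_upD:
  "conc_up hs \<Longrightarrow> k < K \<Longrightarrow> 0 < cnt (take k hs) x a \<Longrightarrow>
   Phat (take k hs) x a y \<le> (1 + eta) * pmf (P x a) y + 40 * real H * L / real (cnt (take k hs) x a)"
  unfolding conc_up_def by blast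

section \<open>Size of the logarithms and of the weights\<close>

lemma SA_ge_1: "1 \<le> S" "1 \<le> A"
  by (simp_all add: S_eq A_eq Suc_le_eq)

lemma T_ge_1: "1 \<le> real (K * H)"
  using H_pos K_pos by (metis mult_le_mono nat_mult_1 of_nat_1 of_nat_le_iff)

lemma SAT_ge_1: "1 \<le> S * A * real (K * H)"
proof -
  have "1 * 1 * 1 \<le> S * A * real (K * H)"
    using SA_ge_1 T_ge_1 by (intro mult_mono) auto
  thus ?thesis by simp
qed

lemma L_args: "5 \<le> 5 * S * A * real (K * H) / \<delta>"
  "5 * S * A * real (K * H) / \<delta> \<le> 5 * real H * S * A * real (K * H) / \<delta>"
proof -
  have "5 * \<delta> \<le> 5 * (S * A * real (K * H))"
    using delta SAT_ge_1 by simp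
  thus "5 \<le> 5 * S * A * real (K * H) / \<delta>"
    using delta by (simp add: field_simps)
  have "1 * (5 * S * A * real (K * H)) \<le> real H * (5 * S * A * real (K * H))"
    using H_pos SA_ge_1 by (intro mult_right_mono) auto
  thus "5 * S * A * real (K * H) / \<delta> \<le> 5 * real H * S * A * real (K * H) / \<delta>"
    using delta by (intro divide_right_mono) (auto simp: mult_ac)
qed

lemma L'_ge_1: "1 \<le> L'"
proof -
  have "exp 1 \<le> 5 * S * A * real (K * H) / \<delta>"
    using exp_le L_args by simp
  thus ?thesis unfolding L'_eq by (subst ln_ge_iff) (use L_args in auto)
qed

lemma L'_le_L: "L' \<le> L"
  unfolding L_eq L'_eq using L_args by (subst ln_le_cancel_iff) auto

lemma L_ge_1: "1 \<le> L"
  using L'_ge_1 L'_le_L by simp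

lemma exp_neg_L: "exp (- L) = \<delta> / (5 * real H * S * A * real (K * H))"
  using L_args unfolding L_eq exp_minus by (subst exp_ln) auto

lemma exp_neg_L': "exp (- L') = \<delta> / (5 * S * A * real (K * H))"
  using L_args unfolding L'_eq exp_minus by (subst exp_ln) auto

lemma ln_T_le_L: "ln (real (K * H)) \<le> L"
proof -
  have "1 * 1 * real (K * H) \<le> S * A * real (K * H)"
    using SA_ge_1 by (intro mult_mono) auto
  also have "\<dots> \<le> 5 * S * A * real (K * H) / 1"
    using SA_ge_1 by simp
  also have "\<dots> \<le> 5 * S * A * real (K * H) / \<delta>"
    using delta SA_ge_1 by (intro divide_left_mono) auto
  finally have "real (K * H) \<le> 5 * real H * S * A * real (K * H) / \<delta>"
    using L_args(2) by simp
  thus ?thesis unfolding L_eq using T_ge_1 by (subst ln_le_cancel_iff) auto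
qed

lemma eta_pos: "0 < eta" "eta \<le> 1"
  using H_pos by (auto simp: eta_def field_simps)

lemma weight_le: "h \<le> H \<Longrightarrow> (1 + eta) ^ h \<le> 53 / 50"
proof -
  assume "h \<le> H"
  hence "(1 + eta) ^ h \<le> (1 + eta) ^ H"
    using eta_pos by (intro power_increasing) auto
  also have "\<dots> \<le> exp eta ^ H"
    using eta_pos by (intro power_mono exp_ge_add_one_self) auto
  \<comment> \<open>By the choice of \<open>eta\<close> the exponents add up to
    \<open>H * eta = 1 / 20\<close>.\<close>
  also have "\<dots> = exp (1 / 20)"
    using H_pos by (simp add: eta_def flip: exp_of_nat_mult)
  also have "\<dots> \<le> 1 + 1 / 20 + (1 / 20)\<^sup>2"
    by (rule exp_bound) auto
  finally show ?thesis by (simp add: power2_eq_square)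
qed

section \<open>Optimism of the iterates\<close>

lemma Q_eq:
  "Q ds h x a = (if 0 < cnt ds x a then
     min (min (if ds = [] then real H else Q (butlast ds) h x a) (real H))
         (R x a + phat ds x a (V ds (Suc h)) + 7 * real H * L' / sqrt (real (cnt ds x a)))
     else real H)"
proof -
  have "bonus_CH H K \<delta> ds h x a = 7 * real H * L' / sqrt (real (cnt ds x a))"
    by (simp add: bonus_CH_def L'_eq S_eq A_eq real_sqrt_divide)
  thus ?thesis by (subst ucbQ.simps) (simp add: ucbV_def)
qed

lemma Q_le_H: "Q ds h x a \<le> real H"
  by (subst Q_eq) auto

lemma V_eq_Q_sel: "h \<le> H \<Longrightarrow> V ds h x = Q ds h x (sel ds x h)"
  using greedy[of ds h x] by (auto simp: ucbV_def intro!: Max_eqI)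

lemma V_ge_Q: "h \<le> H \<Longrightarrow> Q ds h x a \<le> V ds h x"
  using greedy[of ds h x a] by (simp add: V_eq_Q_sel)

lemma V_le_H: "V ds h x \<le> real H"
  by (cases "h \<le> H") (auto simp: V_eq_Q_sel Q_le_H ucbV_def)

lemma V_beyond: "H < h \<Longrightarrow> V ds h x = 0"
  by (simp add: ucbV_def)

lemma Phat_nonneg: "0 \<le> Phat ds x a y"
  by (simp add: Phat_def)

text \<open>Nested induction: the outer one over episodes handles the minimum with the previous
  iterate, the inner one over the remaining steps handles the value at the next step.\<close>

lemma Q_optimistic:
  assumes hs: "conc_opt hs" "length hs = K" and "k < K" "1 \<le> h" "h \<le> H"
  shows "R x a + pexp (P x a) (W (H - h)) \<le> Q (take k hs) h x a"
  using \<open>k < K\<close> \<open>1 \<le> h\<close> \<open>h \<le> H\<close>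
proof (induction k arbitrary: h x a)
  \<comment> \<open>Covers the cap \<open>H\<close> as well as the unvisited pairs;
    \<open>1 \<le> h\<close> gives \<open>Suc (H - h) \<le> H\<close>.\<close>
  have WH: "R x a + pexp (P x a) (W (H - h)) \<le> real H" if "1 \<le> h" "h \<le> H" for h x a
  proof -
    have "R x a + pexp (P x a) (W (H - h)) \<le> W (Suc (H - h)) x"
      by (rule Vopt_ge)
    also have "\<dots> \<le> real (Suc (H - h))"
      by (rule Vopt_le) (rule R_le_1)
    finally show ?thesis using that by simp
  qed
  {
    case 0
    thus ?case using WH by (subst Q_eq) auto
  next
    case (Suc k)
    define ds where "ds = take (Suc k) hs"
    have ds: "ds \<noteq> []" "butlast ds = take k hs"
      using Suc.prems hs by (auto simp: ds_def butlast_take)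
    have "R x a + pexp (P x a) (W (H - h)) \<le> Q ds h x a" if "1 \<le> h" "h \<le> H" for h x a
      using \<open>h \<le> H\<close> \<open>1 \<le> h\<close>
    proof (induction "H - h" arbitrary: h x a rule: less_induct)
      case less
      have V: "W (H - h) y \<le> V ds (Suc h) y" for y
      proof (cases "H = h")
        case True
        thus ?thesis using V_beyond[of "Suc h" ds y] by simp
      next
        case False
        hence h: "Suc h \<le> H" "H - h = Suc (H - Suc h)" using less.prems by auto
        have "R y a + pexp (P y a) (W (H - Suc h)) \<le> V ds (Suc h) y" for a
          using less.hyps[of "Suc h" y a] V_ge_Q[of "Suc h" ds y a] h by simp
        thus ?thesis unfolding h(2) by simp
      qed
      show ?case
      proof (cases "0 < cnt ds x a")
        case True
        let ?N = "real (cnt ds x a)"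
        define B where "B = real H * L' / sqrt ?N"
        have "\<bar>phat ds x a (W (H - h)) - pexp (P x a) (W (H - h))\<bar> \<le> B"
          unfolding ds_def B_def
          using True Suc.prems(1) less.prems H_pos by (intro conc_optD hs(1)) (auto simp: ds_def)
        \<comment> \<open>\<open>B\<close> is the Hoeffding error and \<open>7 * B\<close> the
          bonus, so the bonus absorbs the error.\<close>
        moreover have "B \<le> 7 * B"
        proof -
          have "0 \<le> B" using L'_ge_1 by (simp add: B_def)
          thus ?thesis by simp
        qed
        moreover have "phat ds x a (W (H - h)) \<le> phat ds x a (V ds (Suc h))"
          by (intro sum_mono mult_left_mono V Phat_nonneg)
        ultimately have "R x a + pexp (P x a) (W (H - h))
            \<le> R x a + phat ds x a (V ds (Suc h)) + 7 * B"
          by linarith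
        hence "R x a + pexp (P x a) (W (H - h))
            \<le> R x a + phat ds x a (V ds (Suc h)) + 7 * real H * L' / sqrt ?N"
          by (simp add: B_def)
        moreover have "R x a + pexp (P x a) (W (H - h)) \<le> Q (butlast ds) h x a"
          using Suc.IH[of h x a] Suc.prems less.prems ds by simp
        ultimately show ?thesis
          using WH less.prems ds True by (subst Q_eq) auto
      next
        case False
        thus ?thesis using WH less.prems by (subst Q_eq) auto
      qed
    qed
    thus ?case using Suc.prems unfolding ds_def by simp
  }
qed

lemma V_optimistic:
  assumes "conc_opt hs" "length hs = K" "k < K" "1 \<le> h"
  shows "W (Suc H - h) x \<le> V (take k hs) h x"
proof (cases "h \<le> H")
  case True
  have "R x a + pexp (P x a) (W (H - h)) \<le> V (take k hs) h x" for a
    using Q_optimistic[OF assms True] V_ge_Q[OF True] order_trans by blast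
  thus ?thesis using True by (simp add: Suc_diff_le)
qed (simp add: V_beyond)

section \<open>The recursion for the gap\<close>

lemma gap_nonneg: "0 \<le> gap ds h x"
  by (simp add: gap_def)

lemma gap_le_H: "gap ds h x \<le> real H"
proof -
  have "0 \<le> Vpol P R (sel ds) h (Suc H - h) x"
    by (rule Vpol_nonneg) (rule R_nonneg)
  thus ?thesis using V_le_H[of ds h x] by (simp add: gap_def)
qed

lemma gap_beyond: "H < h \<Longrightarrow> gap ds h x = 0"
  by (simp add: gap_def V_beyond)

lemma wgap_bounds: "0 \<le> wgap ds h x" "wgap ds h x \<le> 53 / 50 * real H"
proof -
  show "0 \<le> wgap ds h x"
    using gap_nonneg eta_pos by (simp add: wgap_def)
  show "wgap ds h x \<le> 53 / 50 * real H"
  proof (cases "h \<le> H")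
    case True
    thus ?thesis unfolding wgap_def using eta_pos
      by (intro mult_mono weight_le gap_le_H gap_nonneg) auto
  qed (simp add: wgap_def gap_beyond)
qed

abbreviation "cost \<equiv> visit_cost H (8 * real H * L) (40 * S * (real H)\<^sup>2 * L)"

text \<open>With \<open>U\<close> the value of the current policy, \<open>phat V - P U\<close>
  splits into \<open>phat (V - W)\<close>, \<open>(phat - P) W\<close> and \<open>P (W - U)\<close>.
  The first is bounded by \<open>conc_up\<close>, the second by \<open>conc_opt\<close>, and the
  third recombines with the first to \<open>P (V - U)\<close>.\<close>

lemma gap_step:
  assumes hs: "conc_opt hs" "conc_up hs" "length hs = K" and k: "k < K" and h: "1 \<le> h" "h \<le> H"
    and a: "a = sel (take k hs) x h"
  shows "gap (take k hs) h x \<le> cost (cnt (take k hs) x a) + (1 + eta) * pexp (P x a) (gap (take k hs) (Suc h))"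
proof -
  define ds where "ds = take k hs"
  define N where "N = cnt ds x a"
  define U where "U = Vpol P R (sel ds) (Suc h) (H - h)"
  have cost_nonneg: "0 \<le> cost N"
    using L_ge_1 SA_ge_1 by (simp add: visit_cost_def)
  have pexp_gap_nonneg: "0 \<le> pexp (P x a) (gap ds (Suc h))"
    using pexp_mono[of "\<lambda>_. 0" "gap ds (Suc h)"] gap_nonneg by (simp add: pexp_const)
  have "gap ds h x \<le> cost N + (1 + eta) * pexp (P x a) (gap ds (Suc h))"
  proof (cases "N < 10 * H")
    case True
    thus ?thesis using gap_le_H[of ds h x] pexp_gap_nonneg eta_pos
      by (simp add: visit_cost_def add_increasing2)
  next
    case False
    hence N: "0 < N" using H_pos by simp
    have UW: "U y \<le> W (H - h) y" for y unfolding U_def by (rule Vpol_le_Vopt)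
    have WV: "W (H - h) y \<le> V ds (Suc h) y" for y
      using V_optimistic[OF hs(1,3) k, of "Suc h" y] by (simp add: ds_def)
    \<comment> \<open>By \<open>U \<le> W \<le> V\<close> the truncation in \<open>gap\<close> is
      inactive.\<close>
    have gap: "gap ds (Suc h) y = V ds (Suc h) y - U y" for y
      using UW[of y] WV[of y] by (simp add: gap_def U_def)
    have "V ds h x \<le> R x a + phat ds x a (V ds (Suc h)) + 7 * real H * L' / sqrt (real N)"
    proof -
      have "V ds h x = Q ds h x a"
        using h by (simp add: V_eq_Q_sel a ds_def)
      also have "\<dots> \<le> R x a + phat ds x a (V ds (Suc h)) + 7 * real H * L' / sqrt (real N)"
        using N unfolding N_def by (subst Q_eq) simp
      finally show ?thesis .
    qed
    moreover have "Vpol P R (sel ds) h (Suc H - h) x = R x a + pexp (P x a) U"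
      using h by (simp add: Suc_diff_le a U_def ds_def)
    ultimately have 1: "V ds h x - Vpol P R (sel ds) h (Suc H - h) x
        \<le> phat ds x a (V ds (Suc h)) - pexp (P x a) U + 7 * real H * L' / sqrt (real N)"
      by linarith
    have 2: "phat ds x a (W (H - h)) - pexp (P x a) (W (H - h)) \<le> real H * L' / sqrt (real N)"
    proof -
      have "\<bar>phat ds x a (W (H - h)) - pexp (P x a) (W (H - h))\<bar> \<le> real H * L' / sqrt (real N)"
        unfolding ds_def N_def
        using N k h H_pos by (intro conc_optD hs(1)) (auto simp: ds_def N_def)
      thus ?thesis by linarith
    qed
    have "phat ds x a (V ds (Suc h)) - phat ds x a (W (H - h))
        = (\<Sum>y\<in>UNIV. Phat ds x a y * (V ds (Suc h) y - W (H - h) y))"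
      by (simp add: sum_subtractf right_diff_distrib)
    \<comment> \<open>Each of the \<open>S\<close> next states contributes the additive error of
      \<open>conc_up\<close> times at most \<open>H\<close>.\<close>
    also have "\<dots> \<le> (\<Sum>y\<in>UNIV. (1 + eta) * (pmf (P x a) y * (V ds (Suc h) y - W (H - h) y))
        + 40 * real H * L / real N * real H)"
    proof (intro sum_mono)
      fix y
      have d: "0 \<le> V ds (Suc h) y - W (H - h) y" "V ds (Suc h) y - W (H - h) y \<le> real H"
        using WV[of y] V_le_H[of ds "Suc h" y] Vopt_nonneg[of R P "H - h" y] R_nonneg by auto
      have "Phat ds x a y \<le> (1 + eta) * pmf (P x a) y + 40 * real H * L / real N"
        unfolding ds_def N_def
        using N k by (intro conc_upD hs(2)) (auto simp: ds_def N_def)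
      hence "Phat ds x a y * (V ds (Suc h) y - W (H - h) y)
          \<le> ((1 + eta) * pmf (P x a) y + 40 * real H * L / real N) * (V ds (Suc h) y - W (H - h) y)"
        using d by (intro mult_right_mono)
      also have "\<dots> = (1 + eta) * (pmf (P x a) y * (V ds (Suc h) y - W (H - h) y))
         + 40 * real H * L / real N * (V ds (Suc h) y - W (H - h) y)"
        by (simp only: distrib_right mult.assoc)
      finally have *: "Phat ds x a y * (V ds (Suc h) y - W (H - h) y)
        \<le> (1 + eta) * (pmf (P x a) y * (V ds (Suc h) y - W (H - h) y))
          + 40 * real H * L / real N * (V ds (Suc h) y - W (H - h) y)" .
      have "40 * real H * L / real N * (V ds (Suc h) y - W (H - h) y) \<le> 40 * real H * L / real N * real H"
        using d L_ge_1 by (intro mult_left_mono) auto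
      with * show "Phat ds x a y * (V ds (Suc h) y - W (H - h) y)
        \<le> (1 + eta) * (pmf (P x a) y * (V ds (Suc h) y - W (H - h) y)) + 40 * real H * L / real N * real H"
        by linarith
    qed
    also have "\<dots> = (1 + eta) * pexp (P x a) (\<lambda>y. V ds (Suc h) y - W (H - h) y)
        + 40 * S * (real H)\<^sup>2 * L / real N"
      by (simp add: sum.distrib pexp_def S_eq power2_eq_square flip: sum_distrib_left)
    finally have 3: "phat ds x a (V ds (Suc h)) - phat ds x a (W (H - h))
        \<le> (1 + eta) * pexp (P x a) (\<lambda>y. V ds (Suc h) y - W (H - h) y) + 40 * S * (real H)\<^sup>2 * L / real N" .
    \<comment> \<open>As \<open>W - U\<close> is nonnegative it may be inflated by
      \<open>1 + eta\<close>, to match the factor in front of \<open>V - W\<close>.\<close>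
    have "1 * pexp (P x a) (\<lambda>y. W (H - h) y - U y) \<le> (1 + eta) * pexp (P x a) (\<lambda>y. W (H - h) y - U y)"
      using pexp_mono[of "\<lambda>_. 0" "\<lambda>y. W (H - h) y - U y" "P x a"] UW eta_pos
      by (intro mult_right_mono) (auto simp: pexp_const)
    hence 4: "pexp (P x a) (W (H - h)) - pexp (P x a) U \<le> (1 + eta) * pexp (P x a) (\<lambda>y. W (H - h) y - U y)"
      by (simp add: pexp_diff)
    have 5: "(1 + eta) * pexp (P x a) (\<lambda>y. V ds (Suc h) y - W (H - h) y)
       + (1 + eta) * pexp (P x a) (\<lambda>y. W (H - h) y - U y) = (1 + eta) * pexp (P x a) (gap ds (Suc h))"
      unfolding gap distrib_left[symmetric] pexp_add[symmetric] by simp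
    have 6: "7 * real H * L' / sqrt (real N) + real H * L' / sqrt (real N) \<le> 8 * real H * L / sqrt (real N)"
    proof -
      have "7 * real H * L' / sqrt (real N) + real H * L' / sqrt (real N) = 8 * real H * L' / sqrt (real N)"
        by (simp flip: add_divide_distrib)
      also have "\<dots> \<le> 8 * real H * L / sqrt (real N)"
        using L'_le_L by (intro divide_right_mono mult_left_mono) auto
      finally show ?thesis .
    qed
    have "cost N = 8 * real H * L / sqrt (real N) + 40 * S * (real H)\<^sup>2 * L / real N"
      using False by (simp add: visit_cost_def)
    hence "V ds h x - Vpol P R (sel ds) h (Suc H - h) x \<le> cost N + (1 + eta) * pexp (P x a) (gap ds (Suc h))"
      using 1 2 3 4 5 6 by linarith
    thus ?thesis
      using cost_nonneg pexp_gap_nonneg eta_pos by (simp add: gap_def[of ds h x])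
  qed
  thus ?thesis by (simp add: ds_def N_def)
qed

text \<open>At each step the expected next gap is replaced by the realised one plus the martingale
  increment \<open>xi\<close>, so that the costs are those of the pairs actually visited.\<close>

lemma wgap_unroll:
  assumes hs: "conc_opt hs" "conc_up hs" "length hs = K" and k: "k < K"
    and "1 \<le> h" "h + length ep = Suc H" "follows (sel (take k hs)) x h ep"
  shows "wgap (take k hs) h x
    \<le> 53 / 50 * sum_list (map (\<lambda>(x, a, y). cost (cnt (take k hs) x a)) ep) + ep_sum (xi (take k hs)) h ep"
  using assms(5-)
proof (induction ep arbitrary: h x)
  case Nil
  \<comment> \<open>An empty remainder means \<open>h = Suc H\<close>, beyond the horizon.\<close>
  thus ?case by (simp add: wgap_def gap_beyond)
next
  case (Cons t ep)
  define ds where "ds = take k hs"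
  define a where "a = sel ds x h"
  obtain y where t: "t = (x, a, y)" and ep: "follows (sel ds) y (Suc h) ep"
    using Cons.prems by (cases t) (auto simp: a_def ds_def)
  have h: "1 \<le> h" "h \<le> H" using Cons.prems by auto
  have cost_nonneg: "0 \<le> cost (cnt ds x a)"
    using L_ge_1 SA_ge_1 by (simp add: visit_cost_def)
  have "wgap ds h x \<le> (1 + eta) ^ h * (cost (cnt ds x a) + (1 + eta) * pexp (P x a) (gap ds (Suc h)))"
    unfolding wgap_def using gap_step[OF hs k h, of a x] eta_pos
    by (intro mult_left_mono) (auto simp: a_def ds_def)
  also have "\<dots> = (1 + eta) ^ h * cost (cnt ds x a) + pexp (P x a) (wgap ds (Suc h))"
    unfolding wgap_def[abs_def] pexp_cmult by (simp add: algebra_simps)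
  finally have 1: "wgap ds h x \<le> (1 + eta) ^ h * cost (cnt ds x a) + pexp (P x a) (wgap ds (Suc h))" .
  have 2: "(1 + eta) ^ h * cost (cnt ds x a) \<le> 53 / 50 * cost (cnt ds x a)"
    using cost_nonneg h by (intro mult_right_mono weight_le)
  have 3: "pexp (P x a) (wgap ds (Suc h)) = xi ds h t + wgap ds (Suc h) y"
    by (simp add: xi_def t)
  have 4: "wgap ds (Suc h) y \<le> 53 / 50 * sum_list (map (\<lambda>(x, a, y). cost (cnt ds x a)) ep) + ep_sum (xi ds) (Suc h) ep"
    using Cons.IH[of "Suc h" y] Cons.prems ep by (simp add: ds_def)
  show ?case using 1 2 3 4
    unfolding ds_def[symmetric] t ep_sum.simps list.map sum_list.Cons prod.case by argo
qed

text \<open>Optimism bounds each episode's regret by its initial gap; unrolling leaves visit costs,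
  paid by the potential, and a martingale sum, bounded by \<open>conc_mart\<close>.\<close>

lemma regret_le_on_good_event:
  assumes hs: "conc_opt hs" "conc_up hs" "conc_mart hs" "length hs = K" "valid_hist H sel init hs"
  shows "regret P R H sel init K hs
    \<le> 20 * real H powr (3/2) * L * sqrt (S * A * real K) + 250 * (real H)\<^sup>2 * S\<^sup>2 * A * L\<^sup>2"
proof -
  let ?c = "\<lambda>k. sum_list (map (\<lambda>(x, a, y). cost (cnt (take k hs) x a)) (hs ! k))"
  have "Vstar1 P R H (init (take k hs)) - Vpi1 P R H (sel (take k hs)) (init (take k hs))
      \<le> 53 / 50 * ?c k + ep_sum (xi (take k hs)) 1 (hs ! k)" if k: "k < K" for k
  proof -
    define ds x where "ds = take k hs" and "x = init ds"
    have "Vstar1 P R H x - Vpi1 P R H (sel ds) x \<le> V ds 1 x - Vpol P R (sel ds) 1 H x"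
      using V_optimistic[OF hs(1,4) k, of 1 x] Vstar1_le_Vopt[of P R H x]
      by (simp add: Vpi1_eq_Vpol ds_def)
    also have "\<dots> \<le> 1 * gap ds 1 x" by (simp add: gap_def)
    also have "\<dots> \<le> wgap ds 1 x"
      unfolding wgap_def using eta_pos gap_nonneg by (intro mult_right_mono) auto
    also have "\<dots> \<le> 53 / 50 * ?c k + ep_sum (xi ds) 1 (hs ! k)"
      unfolding ds_def using hs(5) k hs(4)
      by (intro wgap_unroll hs k) (auto simp: valid_hist_def x_def ds_def)
    finally show ?thesis by (simp add: ds_def x_def)
  qed
  hence "regret P R H sel init K hs \<le> (\<Sum>k<K. 53 / 50 * ?c k + ep_sum (xi (take k hs)) 1 (hs ! k))"
    unfolding regret_def by (intro sum_mono) auto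
  also have "\<dots> = 53 / 50 * (\<Sum>k<length hs. ?c k) + hist_sum xi hs"
    by (simp add: sum.distrib hist_sum_def hs(4) sum_distrib_left)
  finally have reg: "regret P R H sel init K hs \<le> 53 / 50 * (\<Sum>k<length hs. ?c k) + hist_sum xi hs" .
  define B where "B = real H * L * sqrt (S * A * real (K * H))"
  have "(\<Sum>k<length hs. ?c k)
      \<le> (\<Sum>(x, a)\<in>UNIV. visit_pot H (8 * real H * L) (40 * S * (real H)\<^sup>2 * L) (cnt hs x a))"
    using hs(5) H_pos L_ge_1 SA_ge_1
    by (intro visit_costs_le_pot) (auto simp: valid_hist_def)
  also have "\<dots> \<le> 11 * (real H)\<^sup>2 * (S * A) + 8 * real H * L * (41 / 20) * sqrt (S * A * real (K * H))
      + 40 * S * (real H)\<^sup>2 * L * (11 / 10) * L * (S * A)"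
    unfolding S_eq A_eq
  proof (rule sum_visit_pot_le)
    show "length (concat hs) = K * H" using length_concat_valid[OF hs(5)] hs(4) by simp
    show "1 \<le> K * H" using H_pos K_pos by simp
  qed (use L_ge_1 ln_T_le_L in auto)
  also have "\<dots> = 11 * ((real H)\<^sup>2 * (S * A)) + 82 / 5 * B + 44 * ((real H)\<^sup>2 * S\<^sup>2 * A * L\<^sup>2)"
    by (simp add: B_def power2_eq_square)
  finally have cost: "(\<Sum>k<length hs. ?c k)
      \<le> 11 * ((real H)\<^sup>2 * (S * A)) + 82 / 5 * B + 44 * ((real H)\<^sup>2 * S\<^sup>2 * A * L\<^sup>2)" .
  have mart: "hist_sum xi hs \<le> 4 / 5 * B"
  proof -
    have "1 * 1 * real (K * H) \<le> S * A * real (K * H)"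
      using SA_ge_1 by (intro mult_mono) auto
    hence "4 / 5 * real H * L * sqrt (real (K * H)) \<le> 4 / 5 * real H * L * sqrt (S * A * real (K * H))"
      using L_ge_1 by (intro mult_left_mono) auto
    thus ?thesis using hs(3) unfolding conc_mart_def B_def by (simp only: mult.assoc)
  qed
  have "sqrt (S * A * real (K * H)) = sqrt (S * A * real K) * sqrt (real H)"
    by (simp flip: real_sqrt_mult add: mult_ac)
  moreover have "real H powr (3/2) = real H * sqrt (real H)"
  proof -
    have "real H powr (3/2) = real H powr (1 + 1/2)" by simp
    also have "\<dots> = real H powr 1 * real H powr (1/2)" by (rule powr_add)
    finally show ?thesis using H_pos by (simp add: powr_half_sqrt)
  qed
  ultimately have B: "B = real H powr (3/2) * L * sqrt (S * A * real K)"
    by (simp add: B_def)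
  \<comment> \<open>Merges the cost of the rarely visited pairs into the second term of the
    bound.\<close>
  have "((real H)\<^sup>2 * A) * (S * 1) \<le> ((real H)\<^sup>2 * A) * (S\<^sup>2 * L\<^sup>2)"
    using SA_ge_1 L_ge_1
    by (intro mult_left_mono mult_mono one_le_power) (auto simp: power2_eq_square)
  hence 2: "(real H)\<^sup>2 * (S * A) \<le> (real H)\<^sup>2 * S\<^sup>2 * A * L\<^sup>2"
    by (simp add: mult_ac)
  have "0 \<le> B" "0 \<le> (real H)\<^sup>2 * S\<^sup>2 * A * L\<^sup>2"
    using SA_ge_1 L_ge_1 by (auto simp: B_def)
  \<comment> \<open>The coefficients are 1.06 * 16.4 + 0.8 = 18.184 and 1.06 * (11 + 44) =
    58.3.\<close>
  hence "regret P R H sel init K hs \<le> 20 * B + 250 * ((real H)\<^sup>2 * S\<^sup>2 * A * L\<^sup>2)"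
    using reg cost mart 2 by argo
  thus ?thesis by (simp add: B mult.assoc)
qed

end

section \<open>Probability of the good event\<close>

text \<open>The increment vanishes off the pair \<open>(x, a)\<close>, so the count enters as a
  random factor inside the event while \<open>l\<close> stays deterministic.\<close>

lemma prob_visit_hoeffding:
  fixes P :: "'s::finite \<Rightarrow> 'a \<Rightarrow> 's pmf"
  assumes "\<And>y. c \<le> f y" "\<And>y. f y \<le> c + B" "l > 0"
  shows "measure_pmf.prob (hist_pmf P H pol init K) {hs. v \<le> real (cnt (take k hs) x a) *
      (l * ((\<Sum>y\<in>UNIV. Phat (take k hs) x a y * f y) - pexp (P x a) f) - l\<^sup>2 * B\<^sup>2 / 8)} \<le> exp (- v)"
proof -
  let ?c = "l * pexp (P x a) f + l\<^sup>2 * B\<^sup>2 / 8"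
  let ?z = "\<lambda>(x', a', y). if x' = x \<and> a' = a then l * f y - ?c else 0"
  have "(\<integral>\<^sup>+y. ennreal (exp (?z (x', a', y))) \<partial>measure_pmf (P x' a')) \<le> 1" for x' a'
  proof (cases "x' = x \<and> a' = a")
    case True
    have "(\<integral>\<^sup>+y. ennreal (exp (l * (f y - pexp (P x a) f) - l\<^sup>2 * (c + B - c)\<^sup>2 / 8)) \<partial>measure_pmf (P x a)) \<le> 1"
      by (rule hoeffding_pmf) (use assms in auto)
    thus ?thesis using True by (simp add: right_diff_distrib diff_diff_eq)
  qed auto
  hence "measure_pmf.prob (hist_pmf P H pol init K)
      {hs. v \<le> sum_list (map ?z (concat (take k hs)))} \<le> exp (- v)"
    by (rule prob_frozen_ge)
  thus ?thesis
    unfolding sum_list_visits by (simp add: right_diff_distrib diff_diff_eq)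
qed

lemma prob_visit_chernoff:
  fixes P :: "'s::finite \<Rightarrow> 'a \<Rightarrow> 's pmf"
  assumes "0 \<le> l" "l \<le> 1"
  shows "measure_pmf.prob (hist_pmf P H pol init K) {hs. v \<le> real (cnt (take k hs) x a) *
      (l * (Phat (take k hs) x a y - (1 + l) * pmf (P x a) y))} \<le> exp (- v)"
proof -
  let ?c = "l * ((1 + l) * pmf (P x a) y)"
  let ?z = "\<lambda>(x', a', y'). if x' = x \<and> a' = a then l * of_bool (y' = y) - ?c else 0"
  have "(\<integral>\<^sup>+y'. ennreal (exp (?z (x', a', y'))) \<partial>measure_pmf (P x' a')) \<le> 1" for x' a'
  proof (cases "x' = x \<and> a' = a")
    case True
    thus ?thesis using chernoff_pmf[OF assms, of "P x a" y] by (simp only: right_diff_distrib) simp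
  qed auto
  hence "measure_pmf.prob (hist_pmf P H pol init K)
      {hs. v \<le> sum_list (map ?z (concat (take k hs)))} \<le> exp (- v)"
    by (rule prob_frozen_ge)
  moreover have "(\<Sum>y'\<in>UNIV. Phat ds x a y' * of_bool (y' = y)) = Phat ds x a y" for ds :: "('s, 'a) hist"
  proof -
    have "(\<Sum>y'\<in>UNIV. Phat ds x a y' * of_bool (y' = y)) = (\<Sum>y'\<in>UNIV. if y' = y then Phat ds x a y' else 0)"
      by (intro sum.cong) auto
    thus ?thesis by simp
  qed
  ultimately show ?thesis
    unfolding sum_list_visits by (simp only: right_diff_distrib[of l])
qed

lemma ep_sum_affine:
  "ep_sum (\<lambda>h t. l * z h t - c) h ts = l * ep_sum z h ts - c * real (length ts)"
  by (induction ts arbitrary: h) (auto simp: algebra_simps)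

lemma hist_sum_affine:
  "hist_sum (\<lambda>ds h t. l * z ds h t - c) hs = l * hist_sum z hs - c * real (length (concat hs))"
  by (induction hs rule: rev_induct) (auto simp: ep_sum_affine distrib_left)

lemma prob_UN_le:
  assumes "finite I" "\<And>i. i \<in> I \<Longrightarrow> measure_pmf.prob p (B i) \<le> c"
  shows "measure_pmf.prob p (\<Union>i\<in>I. B i) \<le> real (card I) * c"
proof -
  have "measure_pmf.prob p (\<Union>i\<in>I. B i) \<le> (\<Sum>i\<in>I. measure_pmf.prob p (B i))"
    by (intro measure_UNION_le) (use assms in auto)
  also have "\<dots> \<le> (\<Sum>i\<in>I. c)" by (intro sum_mono assms)
  finally show ?thesis by simp
qed

context ucbvi
begin

section \<open>The three failure events and their probabilities\<close>

abbreviation "hp \<equiv> hist_pmf P H sel init K"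

text \<open>The Hoeffding parameter has to be tuned to the random visit count, hence the union over its
  possible values \<open>m\<close>.\<close>

definition bad_opt_at :: "real \<times> 's \<times> 'a \<times> nat \<times> nat \<times> nat \<Rightarrow> ('s, 'a) hist set" where
  "bad_opt_at = (\<lambda>(\<sigma>, x, a, n, k, m). let l = 4 * sqrt (L' / real m) / real H in
     {hs. 2 * L' \<le> real (cnt (take k hs) x a) *
        (l * (phat (take k hs) x a (\<lambda>y. \<sigma> * W n y) - pexp (P x a) (\<lambda>y. \<sigma> * W n y)) - l\<^sup>2 * (real H)\<^sup>2 / 8)})"

definition bad_opt :: "('s, 'a) hist set" where
  "bad_opt = (\<Union>i\<in>{1, -1} \<times> UNIV \<times> UNIV \<times> {..<H} \<times> {..<K} \<times> {1..K * H}. bad_opt_at i)"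

definition bad_up_at :: "'s \<times> 'a \<times> 's \<times> nat \<Rightarrow> ('s, 'a) hist set" where
  "bad_up_at = (\<lambda>(x, a, y, k). {hs. 2 * L \<le> real (cnt (take k hs) x a) *
      (eta * (Phat (take k hs) x a y - (1 + eta) * pmf (P x a) y))})"

definition bad_up :: "('s, 'a) hist set" where
  "bad_up = (\<Union>i\<in>UNIV \<times> UNIV \<times> UNIV \<times> {..<K}. bad_up_at i)"

text \<open>A deterministic parameter suffices here since the number of transitions is always
  \<open>T = K * H\<close>. Up to a constant it minimises \<open>L / lam + lam * C^2 * T / 8\<close>
  for increments of range \<open>C = 53 / 50 * H\<close>.\<close>

definition lam :: real where "lam = 2 * sqrt (L / real (K * H)) / real H"

definition bad_mart :: "('s, 'a) hist set" where
  "bad_mart = {hs. L \<le> hist_sum (\<lambda>ds h t. lam * xi ds h t - lam\<^sup>2 * (53 / 50 * real H)\<^sup>2 / 8) hs}"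

lemma W_bounds: "n < H \<Longrightarrow> 0 \<le> W n y" "n < H \<Longrightarrow> W n y \<le> real H"
proof -
  show "0 \<le> W n y" by (rule Vopt_nonneg) (rule R_nonneg)
  assume "n < H"
  thus "W n y \<le> real H" using Vopt_le[of R P n y] R_le_1 by simp
qed

lemma prob_bad_opt_at:
  assumes "i \<in> {1, -1} \<times> UNIV \<times> UNIV \<times> {..<H} \<times> {..<K} \<times> {1..K * H}"
  shows "measure_pmf.prob hp (bad_opt_at i) \<le> exp (- (2 * L'))"
proof -
  obtain \<sigma> x a n k m where i: "i = (\<sigma>, x, a, n, k, m)" by (cases i)
  have n: "n < H" and \<sigma>: "\<sigma> = 1 \<or> \<sigma> = -1" and m: "m > 0" using assms i by auto
  show ?thesis unfolding bad_opt_at_def i Let_def prod.case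
  proof (rule prob_visit_hoeffding)
    \<comment> \<open>The interval is \<open>[0, H]\<close> or \<open>[- H, 0]\<close>, according to
      the sign.\<close>
    show "(if \<sigma> = 1 then 0 else - real H) \<le> \<sigma> * W n y" for y
      using W_bounds[OF n, of y] \<sigma> by auto
    show "\<sigma> * W n y \<le> (if \<sigma> = 1 then 0 else - real H) + real H" for y
      using W_bounds[OF n, of y] \<sigma> by auto
    show "0 < 4 * sqrt (L' / real m) / real H"
      using L'_ge_1 m H_pos by simp
  qed
qed

text \<open>There are \<open>2 * S * A * T^2\<close> indices with \<open>T = K * H\<close>, one
  factor \<open>T\<close> from \<open>n\<close> and \<open>k\<close> and one from \<open>m\<close>.
  The level \<open>2 * L'\<close> squares the tail and thereby pays for both.\<close>

lemma prob_bad_opt: "measure_pmf.prob hp bad_opt \<le> 2 / 25 * \<delta>"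
proof -
  let ?I = "{1, -1 :: real} \<times> (UNIV :: 's set) \<times> (UNIV :: 'a set) \<times> {..<H} \<times> {..<K} \<times> {1..K * H}"
  have "measure_pmf.prob hp bad_opt \<le> real (card ?I) * exp (- (2 * L'))"
    unfolding bad_opt_def by (intro prob_UN_le prob_bad_opt_at) auto
  also have "real (card ?I) = 2 * S * A * (real (K * H))\<^sup>2"
    by (simp add: card_cartesian_product S_eq A_eq power2_eq_square)
  also have "exp (- (2 * L')) = (\<delta> / (5 * S * A * real (K * H)))\<^sup>2"
    unfolding exp_neg_L'[symmetric] by (simp add: power2_eq_square flip: exp_add)
  also have "2 * S * A * (real (K * H))\<^sup>2 * (\<delta> / (5 * S * A * real (K * H)))\<^sup>2 = 2 / 25 * (\<delta> * (\<delta> / (S * A)))"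
    using SA_ge_1 H_pos K_pos by (simp add: power2_eq_square field_simps)
  also have "\<dots> \<le> 2 / 25 * (\<delta> * 1)"
  proof -
    have "1 * 1 \<le> S * A" using SA_ge_1 by (intro mult_mono) auto
    hence "\<delta> / (S * A) \<le> 1" using delta by (simp add: field_simps)
    thus ?thesis using delta by (intro mult_left_mono) auto
  qed
  finally show ?thesis by simp
qed

lemma prob_bad_up: "measure_pmf.prob hp bad_up \<le> 1 / 25 * \<delta>"
proof -
  let ?I = "(UNIV :: 's set) \<times> (UNIV :: 'a set) \<times> (UNIV :: 's set) \<times> {..<K}"
  have "measure_pmf.prob hp bad_up \<le> real (card ?I) * exp (- (2 * L))"
    unfolding bad_up_def
  proof (intro prob_UN_le)
    fix i :: "'s \<times> 'a \<times> 's \<times> nat"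
    show "measure_pmf.prob hp (bad_up_at i) \<le> exp (- (2 * L))"
      unfolding bad_up_at_def case_prod_unfold
      by (rule prob_visit_chernoff) (use eta_pos in auto)
  qed auto
  also have "real (card ?I) = S\<^sup>2 * A * real K"
    by (simp add: card_cartesian_product S_eq A_eq power2_eq_square)
  also have "exp (- (2 * L)) = (\<delta> / (5 * real H * S * A * real (K * H)))\<^sup>2"
    unfolding exp_neg_L[symmetric] by (simp add: power2_eq_square flip: exp_add)
  also have "S\<^sup>2 * A * real K * (\<delta> / (5 * real H * S * A * real (K * H)))\<^sup>2
      = 1 / 25 * (\<delta> * (\<delta> / (A * real K * real H ^ 4)))"
    using SA_ge_1 H_pos K_pos by (simp add: power2_eq_square power4_eq_xxxx field_simps)
  also have "\<dots> \<le> 1 / 25 * (\<delta> * 1)"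
  proof -
    have "1 * 1 * 1 \<le> A * real K * real H ^ 4"
      using SA_ge_1 H_pos K_pos by (intro mult_mono one_le_power) auto
    hence "\<delta> / (A * real K * real H ^ 4) \<le> 1" using delta by (subst divide_le_eq_1) auto
    thus ?thesis using delta by (intro mult_left_mono) auto
  qed
  finally show ?thesis by simp
qed

lemma lam_pos: "0 < lam"
  using L_ge_1 H_pos K_pos by (simp add: lam_def)

lemma prob_bad_mart: "measure_pmf.prob hp bad_mart \<le> 1 / 5 * \<delta>"
proof -
  let ?C = "53 / 50 * real H"
  have "(\<integral>\<^sup>+y. ennreal (exp (lam * xi ds h (x, a, y) - lam\<^sup>2 * ?C\<^sup>2 / 8)) \<partial>measure_pmf (P x a)) \<le> 1" for ds h x a
  proof -
    let ?f = "\<lambda>y. - wgap ds (Suc h) y"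
    \<comment> \<open>Hoeffding's lemma for \<open>- wgap\<close>, which lies in
      \<open>[- ?C, 0]\<close> for every history, good or bad.\<close>
    have "(\<integral>\<^sup>+y. ennreal (exp (lam * (?f y - pexp (P x a) ?f) - lam\<^sup>2 * (0 - (- ?C))\<^sup>2 / 8)) \<partial>measure_pmf (P x a)) \<le> 1"
      by (rule hoeffding_pmf) (use wgap_bounds[of ds "Suc h"] lam_pos in auto)
    thus ?thesis by (simp add: xi_def pexp_minus)
  qed
  hence "measure_pmf.prob hp bad_mart \<le> exp (- L)"
    unfolding bad_mart_def by (rule prob_hist_sum_ge)
  also have "\<dots> = \<delta> / (5 * (real H * (S * A * real (K * H))))"
    by (simp add: exp_neg_L mult_ac)
  also have "\<dots> \<le> \<delta> / (5 * (1 * 1))"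
    using delta SAT_ge_1 H_pos by (intro divide_left_mono mult_left_mono mult_mono) auto
  finally show ?thesis by simp
qed

section \<open>Concentration outside the failure events\<close>

lemma conc_opt_if_not_bad:
  assumes "hs \<notin> bad_opt" "length hs = K" "valid_hist H sel init hs"
  shows "conc_opt hs"
  unfolding conc_opt_def
proof (intro allI impI)
  fix k n x a
  assume k: "k < K" and n: "n < H" and N0: "0 < cnt (take k hs) x a"
  define N where "N = cnt (take k hs) x a"
  define r where "r = sqrt (L' / real N)"
  \<comment> \<open>The actual count is one of the indices \<open>m\<close> in the union.\<close>
  have N: "N \<in> {1..K * H}"
  proof -
    have "N + cnt (drop k hs) x a = cnt hs x a"
      using cnt_append[of "take k hs" "drop k hs" x a] by (simp add: N_def)
    moreover have "cnt hs x a \<le> length (concat hs)"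
      by (simp add: cnt_eq_length_filter)
    ultimately show ?thesis
      using N0 length_concat_valid[OF assms(3)] assms(2) by (simp add: N_def)
  qed
  have r: "0 < r" "r\<^sup>2 * real N = L'"
    using L'_ge_1 N by (auto simp: r_def)
  have rH: "r \<le> L' / sqrt (real N)"
  proof -
    have "sqrt L' \<le> L'"
      using L'_ge_1 by (intro real_le_lsqrt) (auto simp: power2_eq_square)
    thus ?thesis by (simp add: r_def real_sqrt_divide divide_right_mono)
  qed
  define D where "D = phat (take k hs) x a (W n) - pexp (P x a) (W n)"
  have "\<sigma> * D \<le> real H * r" if "\<sigma> \<in> {1, -1}" for \<sigma>
  proof -
    have "hs \<notin> bad_opt_at (\<sigma>, x, a, n, k, N)"
      using assms(1) that k n N by (auto simp: bad_opt_def)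
    moreover have "phat (take k hs) x a (\<lambda>y. \<sigma> * W n y) - pexp (P x a) (\<lambda>y. \<sigma> * W n y) = \<sigma> * D"
      by (simp add: D_def pexp_cmult right_diff_distrib sum_distrib_left mult_ac)
    \<comment> \<open>For \<open>m = N\<close> the parameter is \<open>l = 4 * r / H\<close>; it
      balances \<open>2 * L' / (N * l)\<close> and \<open>l * H^2 / 8\<close>, each of which becomes
      \<open>H * r / 2\<close>.\<close>
    ultimately have "real N * ((4 * r / real H) * (\<sigma> * D) - (4 * r / real H)\<^sup>2 * (real H)\<^sup>2 / 8) < 2 * L'"
      by (simp add: bad_opt_at_def Let_def r_def[symmetric] N_def[symmetric])
    also have "real N * ((4 * r / real H) * (\<sigma> * D) - (4 * r / real H)\<^sup>2 * (real H)\<^sup>2 / 8)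
        = (4 * r * real N / real H) * (\<sigma> * D) - 2 * (r\<^sup>2 * real N)"
      using H_pos by (simp add: power_divide power_mult_distrib right_diff_distrib)
    finally have "(4 * r * real N / real H) * (\<sigma> * D) < 4 * (r\<^sup>2 * real N)"
      using r(2) by simp
    also have "\<dots> = (4 * r * real N / real H) * (real H * r)"
      using H_pos by (simp add: power2_eq_square)
    finally show ?thesis
      using r(1) N H_pos by (subst (asm) mult_less_cancel_left_pos) auto
  qed
  from this[of 1] this[of "-1"] have "\<bar>D\<bar> \<le> real H * r" by auto
  also have "\<dots> \<le> real H * (L' / sqrt (real N))"
    using rH by (intro mult_left_mono) auto
  finally show "\<bar>phat (take k hs) x a (W n) - pexp (P x a) (W n)\<bar>
      \<le> real H * L' / sqrt (real (cnt (take k hs) x a))"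
    by (simp add: D_def N_def)
qed

lemma conc_up_if_not_bad:
  assumes "hs \<notin> bad_up"
  shows "conc_up hs"
  unfolding conc_up_def
proof (intro allI impI)
  fix k x a y
  assume k: "k < K" and N0: "0 < cnt (take k hs) x a"
  define N where "N = real (cnt (take k hs) x a)"
  define D where "D = Phat (take k hs) x a y - (1 + eta) * pmf (P x a) y"
  have N: "0 < N" using N0 by (simp add: N_def)
  have "hs \<notin> bad_up_at (x, a, y, k)"
    using assms k by (auto simp: bad_up_def)
  hence "N * (eta * D) < 2 * L"
    by (simp add: bad_up_at_def N_def D_def)
  \<comment> \<open>\<open>2 * L / eta = 40 * H * L\<close>.\<close>
  hence "D < 40 * real H * L / N"
    using N H_pos by (simp add: eta_def field_simps)
  thus "Phat (take k hs) x a y \<le> (1 + eta) * pmf (P x a) y + 40 * real H * L / real (cnt (take k hs) x a)"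
    by (simp add: D_def N_def)
qed

lemma conc_mart_if_not_bad:
  assumes "hs \<notin> bad_mart" "length hs = K" "valid_hist H sel init hs"
  shows "conc_mart hs"
proof -
  define T where "T = real (K * H)"
  define r where "r = sqrt (L / T)"
  define X where "X = hist_sum xi hs"
  have T: "1 \<le> T" using T_ge_1 by (simp add: T_def)
  have r: "0 < r" "r\<^sup>2 * T = L"
    using L_ge_1 T by (auto simp: r_def)
  have lam: "lam = 2 * r / real H" by (simp add: lam_def r_def T_def)
  have len: "real (length (concat hs)) = T"
    using length_concat_valid[OF assms(3)] assms(2) by (simp add: T_def)
  have "lam * X - lam\<^sup>2 * (53 / 50 * real H)\<^sup>2 / 8 * T < L"
    using assms(1) unfolding bad_mart_def mem_Collect_eq hist_sum_affine len X_def not_le .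
  \<comment> \<open>With \<open>L = r^2 * T\<close> the two error terms add up to 7809/5000,
    slightly below 8/5; dividing by \<open>2 * r / H\<close> gives the constant 4/5.\<close>
  also have "lam\<^sup>2 * (53 / 50 * real H)\<^sup>2 / 8 * T = 2809 / 5000 * (r\<^sup>2 * T)"
    using H_pos by (simp add: lam power_divide power_mult_distrib)
  finally have "2 * r / real H * X < 7809 / 5000 * (r\<^sup>2 * T)"
    using r(2) by (simp add: lam)
  also have "\<dots> \<le> 8 / 5 * (r\<^sup>2 * T)"
    using T by (intro mult_right_mono) auto
  also have "\<dots> = 2 * r / real H * (4 / 5 * real H * (r * T))"
    using H_pos by (simp add: power2_eq_square)
  finally have "X < 4 / 5 * real H * (r * T)"
    using r(1) H_pos by (subst (asm) mult_less_cancel_left_pos) auto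
  also have "r * T = sqrt L * sqrt T"
    using T by (simp add: r_def real_sqrt_divide field_simps)
  also have "4 / 5 * real H * (sqrt L * sqrt T) \<le> 4 / 5 * real H * (L * sqrt T)"
    using L_ge_1 T by (intro mult_left_mono mult_right_mono real_le_lsqrt) (auto simp: power2_eq_square)
  finally show ?thesis by (simp add: conc_mart_def X_def T_def mult_ac)
qed

lemma regret_bound_prob:
  "1 - \<delta> \<le> measure_pmf.prob hp {hs. regret P R H sel init K hs
    \<le> 20 * real H powr (3/2) * L * sqrt (S * A * real K) + 250 * (real H)\<^sup>2 * S\<^sup>2 * A * L\<^sup>2}"
    (is "_ \<le> measure_pmf.prob hp ?G")
proof -
  let ?B = "bad_opt \<union> (bad_up \<union> bad_mart)"
  have "measure_pmf.prob hp (- ?G) \<le> measure_pmf.prob hp ?B"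
  proof (rule measure_pmf.finite_measure_mono_AE)
    \<comment> \<open>The inclusion is proved on the support only, where histories have
      \<open>K\<close> episodes and are valid.\<close>
    show "AE hs in hp. hs \<in> - ?G \<longrightarrow> hs \<in> ?B"
    proof (rule AE_pmfI, intro impI)
      fix hs
      assume hs: "hs \<in> set_pmf hp" "hs \<in> - ?G"
      show "hs \<in> ?B"
      proof (rule ccontr)
        assume "hs \<notin> ?B"
        hence "hs \<in> ?G"
          using set_hist_pmf[OF hs(1)] regret_le_on_good_event[of hs]
            conc_opt_if_not_bad[of hs] conc_up_if_not_bad[of hs] conc_mart_if_not_bad[of hs]
          by blast
        thus False using hs(2) by blast
      qed
    qed
  qed auto
  also have "\<dots> \<le> measure_pmf.prob hp bad_opt + (measure_pmf.prob hp bad_up + measure_pmf.prob hp bad_mart)"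
    by (intro order.trans[OF measure_Un_le] add_left_mono measure_Un_le) auto
  \<comment> \<open>The total is 2/25 + 1/25 + 1/5 = 8/25 of \<open>\<delta>\<close>.\<close>
  also have "\<dots> \<le> \<delta>"
    using prob_bad_opt prob_bad_up prob_bad_mart delta by linarith
  finally show ?thesis
    using measure_pmf.prob_compl[of ?G hp] by (simp add: Compl_eq_Diff_UNIV)
qed

end

theorem theorem1:
  fixes P :: "'s::finite \<Rightarrow> 'a::finite \<Rightarrow> 's pmf"
    and R :: "'s \<Rightarrow> 'a \<Rightarrow> real"
    and H K :: nat
    and \<delta> :: real
    and init :: "('s, 'a) hist \<Rightarrow> 's"
    and sel :: "('s, 'a) hist \<Rightarrow> 's \<Rightarrow> nat \<Rightarrow> 'a"
  assumes R_range: "\<forall>x a. 0 \<le> R x a \<and> R x a \<le> 1"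
    and H_pos: "1 \<le> H"
    and K_pos: "1 \<le> K"
    and delta_pos: "0 < \<delta>"
    and greedy: "\<forall>ds x h a. ucbQ H R (bonus_CH H K \<delta>) ds h x a
                             \<le> ucbQ H R (bonus_CH H K \<delta>) ds h x (sel ds x h)"
  shows "measure_pmf.prob (hist_pmf P H sel init K)
           {hs. regret P R H sel init K hs
                \<le> 20 * real H powr (3/2)
                     * ln (5 * real H * real CARD('s) * real CARD('a) * real (K * H) / \<delta>)
                     * sqrt (real CARD('s) * real CARD('a) * real K)
                  + 250 * (real H)\<^sup>2 * (real CARD('s))\<^sup>2 * real CARD('a)
                     * (ln (5 * real H * real CARD('s) * real CARD('a) * real (K * H) / \<delta>))\<^sup>2}
         \<ge> 1 - \<delta>"
proof (cases "\<delta> < 1")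
  case True
  interpret ucbvi P R H K \<delta> init sel "real CARD('s)" "real CARD('a)"
    "ln (5 * real H * real CARD('s) * real CARD('a) * real (K * H) / \<delta>)"
    "ln (5 * real CARD('s) * real CARD('a) * real (K * H) / \<delta>)"
    by unfold_locales (use assms True in auto)
  show ?thesis by (rule regret_bound_prob)
next
  case False
  \<comment> \<open>For \<open>\<delta> \<ge> 1\<close> the claimed lower bound on the probability
    is not positive.\<close>
  hence "1 - \<delta> \<le> 0" by simp
  also have "0 \<le> measure_pmf.prob (hist_pmf P H sel init K) X" for X
    by simp
  finally show ?thesis .
qed

end
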